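(* For any positive rational numbers $c_1,\dots,c_k$ and $f_1,\dots,f_k$, the function $F(x)=c_1E_\Delta(f_1x)+\cdots+c_kE_\Delta(f_kx)$ satisfies $F(x)=\Omega_\pm(x\sqrt{\log\log x})$, i.e. \[\limsup_{x\to\infty}\frac{F(x)}{x\sqrt{\log\log x}}>0\quad\text{and}\quad\liminf_{x\to\infty}\frac{F(x)}{x\sqrt{\log\log x}}<0.\]
   Context: $\phi$ is Euler's totient function and, for real $t>0$, $E_\Delta(t)=\sum_{1\le m\le t}\phi(m)-\frac{3}{\pi^2}t^2+1$. (Equivalently, $E_\Delta(t)=\#(t\Delta\cap\mathcal{P})-\frac{3}{\pi^2}t^2$, where $\Delta$ is the triangle with vertices $(0,0),(1,0),(1,1)$ and $\mathcal P$ is the set of integer points $(m,n)$ with $\gcd(m,n)=1$.) *)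

theory Defs
  imports "HOL-Analysis.Analysis" "HOL-Number_Theory.Totient"
begin

text \<open>For \<open>t \<ge> 1\<close> this is the number of primitive integer points in the triangle with vertices
  \<open>(0,0)\<close>, \<open>(t,0)\<close>, \<open>(t,t)\<close>, minus its expected main term; the summand \<open>1\<close> counts the
  point \<open>(1,0)\<close>.\<close>

definition E_Delta :: "real \<Rightarrow> real" where
  "E_Delta t = (\<Sum>m | 1 \<le> m \<and> real m \<le> t. real (totient m)) - 3 / pi\<^sup>2 * t\<^sup>2 + 1"

text \<open>Limits superior and inferior are taken in the extended reals, so infinite values are allowed.
  If \<open>g\<close> is not eventually nonzero, the division convention \<open>y / 0 = 0\<close> interferes; the intended
  \<open>g\<close> are eventually positive.\<close>

definition Omega_plus_minus :: "(real \<Rightarrow> real) \<Rightarrow> (real \<Rightarrow> real) \<Rightarrow> bool" where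
  "Omega_plus_minus F g \<longleftrightarrow>
     Limsup at_top (\<lambda>x. ereal (F x / g x)) > 0 \<and>
     Liminf at_top (\<lambda>x. ereal (F x / g x)) < 0"

end

theory Submission
  imports Defs "HOL-Computational_Algebra.Squarefree" "HOL-Real_Asymp.Real_Asymp"
begin

text \<open>Let \<open>\<psi>(u) = frac u - 1/2\<close>. Moebius inversion gives
  \<open>E(t) = - t (\<Sum>d\<le>D. \<mu>(d) \<psi>(t/d) / d) + O(t)\<close> whenever \<open>t \<le> D = O(t)\<close>, and errors \<open>O(t)\<close> are
  harmless here. The right-hand side is averaged over \<open>x = \<nu> P (4 k + r)\<close> with \<open>P \<le> k < 2 P\<close>, where
  \<open>P\<close> is a product of primes \<open>p \<equiv> 3 (mod 4)\<close> up to \<open>z\<close>, where \<open>\<nu>\<close> is chosen such that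
  \<open>f\<^sub>i \<nu> = 1 / (4 b\<^sub>i)\<close> with \<open>b\<^sub>i\<close> a natural number prime to \<open>P\<close>, and \<open>r\<close> is \<open>1\<close> or \<open>3\<close>.
  For \<open>d \<le> P\<close> the mean of \<open>\<psi>(f\<^sub>i x / d)\<close> is evaluated over complete residue systems and is
  proportional to \<open>- \<chi>(r) \<chi>(P/g) g / d\<close> with \<open>g = gcd d P\<close> and \<open>\<chi>\<close> the odd character modulo
  4; for \<open>d > P\<close> the sawtooth is sampled with a step smaller than 1 and its mean is negligible. Thus
  no cancellation in sums of \<open>\<mu>\<close>, and no prime number theorem, is needed. Since \<open>\<chi>(g) = \<mu>(g)\<close>
  for \<open>g dvd P\<close>, all the dominant terms have the same sign, the main term has order
  \<open>\<Sum>g dvd P. 1/g = \<Prod>p dvd P. 1 + 1/p\<close>, and \<open>r\<close> decides its sign.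

  This product is at least of order \<open>sqrt (ln z)\<close>, while \<open>ln (ln x)\<close> is at most of order \<open>ln z\<close>.
  Indeed, changing the value of the completely multiplicative function \<open>\<chi>\<close> from \<open>-1\<close> to \<open>1\<close> at
  a prime \<open>p\<close> multiplies the bound for the partial sums of \<open>\<chi>(n)/n\<close> by at most
  \<open>(1 + 1/p) / (1 - 1/p)\<close>, and after all primes \<open>p \<equiv> 3 (mod 4)\<close> up to \<open>z\<close> have been treated,
  these sums are those of \<open>1/n\<close> over the odd \<open>n \<le> z\<close>.\<close>

section \<open>The summatory totient function\<close>

definition moebius :: "nat \<Rightarrow> real" where
  "moebius n = (if squarefree n then (-1) ^ card (prime_factors n) else 0)"

definition sawtooth :: "real \<Rightarrow> real" where
  "sawtooth u = frac u - 1 / 2"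

lemma sum_multiples:
  fixes h :: "nat \<Rightarrow> 'a::comm_monoid_add"
  assumes "d > 0"
  shows "(\<Sum>n\<in>{n\<in>{1..M}. d dvd n}. h n) = (\<Sum>e=1..M div d. h (d * e))"
proof -
  have "{n\<in>{1..M}. d dvd n} = (*) d ` {1..M div d}"
  proof (intro set_eqI iffI)
    fix n assume "n \<in> {n\<in>{1..M}. d dvd n}"
    then obtain e where "n = d * e" "1 \<le> n" "n \<le> M" by auto
    then show "n \<in> (*) d ` {1..M div d}"
      using assms by (auto simp: less_eq_div_iff_mult_less_eq mult.commute Suc_le_eq)
  qed (use assms in \<open>auto simp: less_eq_div_iff_mult_less_eq mult.commute Suc_le_eq\<close>)
  moreover have "inj_on ((*) d) {1..M div d}"
    using assms by (auto simp: inj_on_def)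
  ultimately show ?thesis
    by (simp add: sum.reindex)
qed

lemma sum_divisors_swap:
  fixes F :: "nat \<Rightarrow> nat \<Rightarrow> 'a::comm_monoid_add"
  shows "(\<Sum>n=1..M. \<Sum>d | d dvd n. F d n) = (\<Sum>d=1..M. \<Sum>e=1..M div d. F d (d * e))"
proof -
  have "(\<Sum>n=1..M. \<Sum>d | d dvd n. F d n) = (\<Sum>n=1..M. \<Sum>d\<in>{d\<in>{1..M}. d dvd n}. F d n)"
  proof (intro sum.cong refl)
    fix n assume "n \<in> {1..M}"
    then show "{d. d dvd n} = {d\<in>{1..M}. d dvd n}"
      by (auto dest: dvd_imp_le simp: Suc_le_eq intro: Nat.gr0I)
  qed
  also have "\<dots> = (\<Sum>d=1..M. \<Sum>n\<in>{n\<in>{1..M}. d dvd n}. F d n)"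
    by (rule sum.swap_restrict) auto
  also have "\<dots> = (\<Sum>d=1..M. \<Sum>e=1..M div d. F d (d * e))"
    by (intro sum.cong refl sum_multiples) auto
  finally show ?thesis .
qed

lemma abs_moebius_le_1: "\<bar>moebius n\<bar> \<le> 1"
  by (simp add: moebius_def power_abs)

lemma moebius_1 [simp]: "moebius (Suc 0) = 1"
  by (simp add: moebius_def flip: One_nat_def)

lemma moebius_prime_mult:
  assumes "prime p" "\<not> p dvd d"
  shows "moebius (p * d) = - moebius d"
proof -
  have cop: "coprime p d"
    using assms by (simp add: prime_imp_coprime)
  have sq: "squarefree (p * d) \<longleftrightarrow> squarefree d"
    using squarefree_mult_coprime[OF cop squarefree_prime[OF assms(1)]] by (auto dest: squarefree_multD)
  have "d \<noteq> 0" "p \<noteq> 0" using assms by (auto intro: Nat.gr0I)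
  then have "prime_factors (p * d) = insert p (prime_factors d)"
    using assms(1) by (simp add: prime_factors_product prime_prime_factors)
  moreover have "p \<notin> prime_factors d"
    using assms(2) by (auto dest: in_prime_factors_imp_dvd)
  ultimately show ?thesis
    by (simp add: moebius_def sq)
qed

text \<open>Fix a prime p dividing n. Each divisor d prime to p is paired with p d, and the two
  values cancel; every remaining divisor is divisible by p^2 and contributes 0.\<close>

lemma sum_moebius_divisors:
  assumes "n > 0"
  shows "(\<Sum>d | d dvd n. moebius d) = (if n = 1 then 1 else 0)"
proof (cases "n = 1")
  case False
  then obtain p where p: "prime p" "p dvd n"
    using prime_factor_nat by blast
  define B where "B = {d. d dvd n \<and> \<not> p dvd d}"
  have fin: "finite {d. d dvd n}" using assms by simp
  have finB: "finite B" using fin unfolding B_def by (rule finite_subset[rotated]) auto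
  have sub: "B \<union> (*) p ` B \<subseteq> {d. d dvd n}"
    using p by (auto simp: B_def prime_imp_coprime intro: divides_mult)
  have zero: "moebius d = 0" if "d dvd n" "d \<notin> B \<union> (*) p ` B" for d
  proof -
    from that have "p dvd d" by (auto simp: B_def)
    then obtain e where e: "d = p * e" by auto
    have "e dvd n" using that e by (metis dvd_mult_right)
    then have "p dvd e" using that e by (auto simp: B_def)
    then have "p ^ 2 dvd d" using e by (auto simp: power2_eq_square)
    then have "\<not> squarefree d"
      using p by (metis not_squarefreeI not_prime_unit)
    then show ?thesis by (simp add: moebius_def)
  qed
  have "(\<Sum>d | d dvd n. moebius d) = (\<Sum>d\<in>B \<union> (*) p ` B. moebius d)"
    by (rule sum.mono_neutral_right) (use fin sub zero in auto)
  also have "\<dots> = (\<Sum>d\<in>B. moebius d) + (\<Sum>d\<in>(*) p ` B. moebius d)"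
    using finB by (intro sum.union_disjoint) (auto simp: B_def)
  also have "(\<Sum>d\<in>(*) p ` B. moebius d) = (\<Sum>d\<in>B. moebius (p * d))"
    using p by (subst sum.reindex) (auto simp: inj_on_def)
  also have "\<dots> = (\<Sum>d\<in>B. - moebius d)"
    using p by (intro sum.cong) (auto simp: B_def moebius_prime_mult)
  finally show ?thesis using False by (simp add: sum_negf)
qed simp

text \<open>Summing \<open>moebius\<close> over the divisors of gcd(k, n) detects coprimality; for
  each d there are n div d multiples of d up to n.\<close>

lemma totient_eq_sum_moebius:
  assumes "n > 0"
  shows "real (totient n) = (\<Sum>d | d dvd n. moebius d * real (n div d))"
proof -
  have fin: "finite {d. d dvd n}" using assms by simp
  have "real (totient n) = (\<Sum>k\<in>totatives n. 1)"
    by (simp add: totient_def)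
  also have "totatives n = {k\<in>{1..n}. gcd k n = 1}"
    by (auto simp: in_totatives_iff coprime_iff_gcd_eq_1)
  also have "(\<Sum>k\<in>{k\<in>{1..n}. gcd k n = 1}. 1::real) = (\<Sum>k=1..n. if gcd k n = 1 then 1 else 0)"
    by (subst sum.inter_filter) auto
  also have "\<dots> = (\<Sum>k=1..n. \<Sum>d | d dvd gcd k n. moebius d)"
    by (intro sum.cong refl) (subst sum_moebius_divisors, use assms in auto)
  also have "\<dots> = (\<Sum>k=1..n. \<Sum>d\<in>{d\<in>{d. d dvd n}. d dvd k}. moebius d)"
    by (intro sum.cong refl) auto
  also have "\<dots> = (\<Sum>d | d dvd n. \<Sum>k\<in>{k\<in>{1..n}. d dvd k}. moebius d)"
    by (rule sum.swap_restrict) (use fin in auto)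
  also have "\<dots> = (\<Sum>d | d dvd n. \<Sum>e=1..n div d. moebius d)"
    by (intro sum.cong refl sum_multiples) (use assms in \<open>auto intro: Nat.gr0I\<close>)
  finally show ?thesis by (simp add: mult.commute)
qed

text \<open>After writing n = d e, the sum over e up to M div d is a triangular number. Expanding
  this quadratic is what later produces the sawtooth.\<close>

lemma sum_totient_eq:
  "(\<Sum>n=1..M. real (totient n)) = (\<Sum>d=1..M. moebius d * (real (M div d) * (real (M div d) + 1) / 2))"
proof -
  have gauss: "(\<Sum>e=1..m. real e) = real m * (real m + 1) / 2" for m
    by (induction m) (auto simp: field_simps)
  have "(\<Sum>n=1..M. real (totient n)) = (\<Sum>n=1..M. \<Sum>d | d dvd n. moebius d * real (n div d))"
    by (intro sum.cong refl totient_eq_sum_moebius) auto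
  also have "\<dots> = (\<Sum>d=1..M. \<Sum>e=1..M div d. moebius d * real (d * e div d))"
    by (rule sum_divisors_swap)
  also have "\<dots> = (\<Sum>d=1..M. moebius d * (\<Sum>e=1..M div d. real e))"
    by (intro sum.cong refl) (auto simp: sum_distrib_left)
  also have "\<dots> = (\<Sum>d=1..M. moebius d * (real (M div d) * (real (M div d) + 1) / 2))"
    by (simp only: gauss)
  finally show ?thesis .
qed

section \<open>Tails and value of the series of mu(d)/d^2\<close>

lemma sum_inverse_squares_le:
  fixes m n :: nat
  assumes "m > 0"
  shows "(\<Sum>d\<in>{m<..n}. 1 / (real d)\<^sup>2) \<le> 1 / real m"
proof -
  \<comment> \<open>The extra -1/n makes the induction telescope, through 1/(n+1)^2 <= 1/n -
    1/(n+1).\<close>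
  have "(\<Sum>d\<in>{m<..n}. 1 / (real d)\<^sup>2) \<le> 1 / real m - 1 / real n" if "m \<le> n"
    using that
  proof (induction n rule: dec_induct)
    case (step n)
    have "{m<..Suc n} = insert (Suc n) {m<..n}" using step by auto
    moreover have "1 / (real (Suc n))\<^sup>2 \<le> 1 / real n - 1 / real (Suc n)"
      using step assms by (simp add: divide_simps power2_eq_square)
    ultimately show ?case using step by simp
  qed simp
  then show ?thesis
    by (cases "m \<le> n") (auto intro: order_trans)
qed

lemma summable_moebius_squares: "summable (\<lambda>d. moebius d / (real d)\<^sup>2)"
proof (rule summable_comparison_test')
  show "summable (\<lambda>d. 1 / (real d)\<^sup>2)"
    using inverse_power_summable[of 2, where ?'a = real] by (simp add: divide_inverse)
  show "norm (moebius d / (real d)\<^sup>2) \<le> 1 / (real d)\<^sup>2" if "d \<ge> 0" for d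
    using abs_moebius_le_1[of d] by (simp add: abs_mult divide_right_mono)
qed

lemma moebius_squares_tail:
  assumes "m > 0"
  shows "\<bar>(\<Sum>d. moebius d / (real d)\<^sup>2) - (\<Sum>d=1..m. moebius d / (real d)\<^sup>2)\<bar> \<le> 1 / real m"
proof -
  have lim: "(\<lambda>n. \<Sum>d\<le>n. moebius d / (real d)\<^sup>2) \<longlonglongrightarrow> (\<Sum>d. moebius d / (real d)\<^sup>2)"
    by (rule summable_LIMSEQ'[OF summable_moebius_squares])
  have "(\<lambda>n. \<bar>(\<Sum>d\<le>n. moebius d / (real d)\<^sup>2) - (\<Sum>d=1..m. moebius d / (real d)\<^sup>2)\<bar>) \<longlonglongrightarrow>
     \<bar>(\<Sum>d. moebius d / (real d)\<^sup>2) - (\<Sum>d=1..m. moebius d / (real d)\<^sup>2)\<bar>"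
    by (intro tendsto_intros lim)
  moreover have "\<forall>\<^sub>F n in sequentially. \<bar>(\<Sum>d\<le>n. moebius d / (real d)\<^sup>2) - (\<Sum>d=1..m. moebius d / (real d)\<^sup>2)\<bar> \<le> 1 / real m"
    using eventually_ge_at_top[of m]
  proof eventually_elim
    case (elim n)
    have "{..n} = insert 0 ({1..m} \<union> {m<..n})" using elim by auto
    then have "(\<Sum>d\<le>n. moebius d / (real d)\<^sup>2) =
        (\<Sum>d=1..m. moebius d / (real d)\<^sup>2) + (\<Sum>d\<in>{m<..n}. moebius d / (real d)\<^sup>2)"
      by (simp add: sum.union_disjoint ivl_disj_int_two)
    then have "\<bar>(\<Sum>d\<le>n. moebius d / (real d)\<^sup>2) - (\<Sum>d=1..m. moebius d / (real d)\<^sup>2)\<bar> \<le>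
       (\<Sum>d\<in>{m<..n}. \<bar>moebius d / (real d)\<^sup>2\<bar>)"
      using sum_abs[of "\<lambda>d. moebius d / (real d)\<^sup>2" "{m<..n}"] by simp
    also have "\<dots> \<le> (\<Sum>d\<in>{m<..n}. 1 / (real d)\<^sup>2)"
      using abs_moebius_le_1 by (intro sum_mono) (auto simp: divide_right_mono)
    also have "\<dots> \<le> 1 / real m"
      by (rule sum_inverse_squares_le[OF assms])
    finally show ?case .
  qed
  ultimately show ?thesis
    by (intro tendsto_upperbound) auto
qed

lemma zeta_2_tail:
  assumes "m > 0"
  shows "\<bar>pi\<^sup>2 / 6 - (\<Sum>e=1..m. 1 / (real e)\<^sup>2)\<bar> \<le> 1 / real m"
proof -
  have lim: "(\<lambda>n. \<Sum>e=1..n. 1 / (real e)\<^sup>2) \<longlonglongrightarrow> pi\<^sup>2 / 6"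
    using inverse_squares_sums
    by (simp add: sums_def sum.atLeast1_atMost_eq add.commute del: sum.cl_ivl_Suc)
  have "(\<lambda>n. \<bar>(\<Sum>e=1..n. 1 / (real e)\<^sup>2) - (\<Sum>e=1..m. 1 / (real e)\<^sup>2)\<bar>) \<longlonglongrightarrow>
     \<bar>pi\<^sup>2 / 6 - (\<Sum>e=1..m. 1 / (real e)\<^sup>2)\<bar>"
    by (intro tendsto_intros lim)
  moreover have "\<forall>\<^sub>F n in sequentially. \<bar>(\<Sum>e=1..n. 1 / (real e)\<^sup>2) - (\<Sum>e=1..m. 1 / (real e)\<^sup>2)\<bar> \<le> 1 / real m"
    using eventually_ge_at_top[of m]
  proof eventually_elim
    case (elim n)
    have "{1..n} = {1..m} \<union> {m<..n}" using elim assms by auto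
    then have "(\<Sum>e=1..n. 1 / (real e)\<^sup>2) = (\<Sum>e=1..m. 1 / (real e)\<^sup>2) + (\<Sum>e\<in>{m<..n}. 1 / (real e)\<^sup>2)"
      by (simp add: sum.union_disjoint ivl_disj_int_two)
    then show ?case
      using sum_inverse_squares_le[OF assms, of n] by (simp add: sum_nonneg)
  qed
  ultimately show ?thesis
    by (intro tendsto_upperbound) auto
qed

text \<open>The identity \<open>\<Sum>\<^bsub>d e \<le> m\<^esub> \<mu>(d) / (d e)\<^sup>2 = 1\<close> is compared with the product of the two series.\<close>

lemma suminf_moebius_squares: "(\<Sum>d. moebius d / (real d)\<^sup>2) = 6 / pi\<^sup>2"
proof -
  let ?m = "\<lambda>M. \<Sum>d=1..M. moebius d / (real d)\<^sup>2"
  have id: "(\<Sum>d=1..M. moebius d / (real d)\<^sup>2 * (\<Sum>e=1..M div d. 1 / (real e)\<^sup>2)) = 1" if "M > 0" for M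
  proof -
    have "(\<Sum>n=1..M. \<Sum>d | d dvd n. moebius d / (real n)\<^sup>2) = (\<Sum>n=1..M. if n = 1 then 1 else 0)"
      by (intro sum.cong refl) (auto simp: sum_moebius_divisors simp flip: sum_divide_distrib)
    also have "\<dots> = 1" using that by (simp add: sum.delta)
    finally show ?thesis
      unfolding sum_divisors_swap by (simp add: sum_distrib_left power_mult_distrib)
  qed
  \<comment> \<open>Completing each inner sum to pi^2/6 costs at most 1/(M div d) <= 2 d/M. Weighted
    by 1/d^2, these errors add up to 2 \<open>harm M\<close>/M, which tends to 0.\<close>
  have bound: "\<bar>?m M * (pi\<^sup>2 / 6) - 1\<bar> \<le> 2 * harm M / real M" if "M > 0" for M
  proof -
    have "?m M * (pi\<^sup>2 / 6) - 1 =
       (\<Sum>d=1..M. moebius d / (real d)\<^sup>2 * (pi\<^sup>2 / 6 - (\<Sum>e=1..M div d. 1 / (real e)\<^sup>2)))"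
      unfolding right_diff_distrib sum_subtractf id[OF that] by (simp add: sum_distrib_right)
    also have "\<bar>\<dots>\<bar> \<le> (\<Sum>d=1..M. 2 / real M * inverse (real d))"
    proof (rule order_trans[OF sum_abs], rule sum_mono)
      fix d assume d: "d \<in> {1..M}"
      then have pos: "M div d > 0" by (simp add: div_greater_zero_iff)
      have "M < d * (M div d + 1)" using d by (simp add: dividend_less_times_div)
      also have "\<dots> \<le> d * (2 * (M div d))" using pos by (intro mult_le_mono2) simp
      finally have "M \<le> 2 * d * (M div d)" by (simp add: ac_simps)
      then have "real M \<le> 2 * real d * real (M div d)"
        by (metis of_nat_le_iff of_nat_mult of_nat_numeral)
      then have le: "1 / real (M div d) \<le> 2 * real d / real M"
        using pos d by (simp add: field_simps)
      have "\<bar>moebius d / (real d)\<^sup>2 * (pi\<^sup>2 / 6 - (\<Sum>e=1..M div d. 1 / (real e)\<^sup>2))\<bar>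
         \<le> 1 / (real d)\<^sup>2 * (2 * real d / real M)"
        unfolding abs_mult using abs_moebius_le_1[of d]
        by (intro mult_mono order_trans[OF zeta_2_tail[OF pos] le]) (auto simp: divide_right_mono)
      also have "\<dots> = 2 / real M * inverse (real d)"
        using d by (simp add: field_simps power2_eq_square)
      finally show "\<bar>moebius d / (real d)\<^sup>2 * (pi\<^sup>2 / 6 - (\<Sum>e=1..M div d. 1 / (real e)\<^sup>2))\<bar>
         \<le> 2 / real M * inverse (real d)" .
    qed
    also have "\<dots> = 2 * harm M / real M"
      by (simp add: harm_def sum_distrib_left sum_divide_distrib)
    finally show ?thesis .
  qed
  have lim0: "(\<lambda>M. 2 * harm M / real M) \<longlonglongrightarrow> 0"
  proof -
    have "(\<lambda>M. harm M - ln (real M)) \<longlonglongrightarrow> euler_mascheroni"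
      by (rule euler_mascheroni_LIMSEQ)
    moreover have "(\<lambda>M. 1 / real M) \<longlonglongrightarrow> 0" by real_asymp
    ultimately have "(\<lambda>M. 2 * ((harm M - ln (real M)) * (1 / real M) + ln (real M) / real M)) \<longlonglongrightarrow> 2 * (euler_mascheroni * 0 + 0)"
      by (intro tendsto_add tendsto_mult tendsto_const; (assumption | real_asymp)?)
    then show ?thesis by (simp add: field_simps diff_divide_distrib)
  qed
  have "(\<lambda>M. ?m M * (pi\<^sup>2 / 6) - 1) \<longlonglongrightarrow> 0"
    by (rule Lim_null_comparison[OF _ lim0])
       (use eventually_gt_at_top[of 0] in \<open>eventually_elim, use bound in auto\<close>)
  moreover have "?m \<longlonglongrightarrow> (\<Sum>d. moebius d / (real d)\<^sup>2)"
  proof -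
    have "(\<Sum>d\<le>M. moebius d / (real d)\<^sup>2) = ?m M" for M
      by (rule sum.mono_neutral_right) (auto simp: Suc_le_eq)
    then show ?thesis
      using summable_LIMSEQ'[OF summable_moebius_squares] by simp
  qed
  then have "(\<lambda>M. ?m M * (pi\<^sup>2 / 6) - 1) \<longlonglongrightarrow> (\<Sum>d. moebius d / (real d)\<^sup>2) * (pi\<^sup>2 / 6) - 1"
    by (intro tendsto_intros)
  ultimately have "(\<Sum>d. moebius d / (real d)\<^sup>2) * (pi\<^sup>2 / 6) - 1 = 0"
    using LIMSEQ_unique by blast
  then show ?thesis by (simp add: field_simps)
qed

section \<open>Sums of the sawtooth function\<close>

lemma abs_frac_square_diff_le: "\<bar>(frac u)\<^sup>2 - frac u\<bar> \<le> 1 / 4" for u :: real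
proof -
  have "0 \<le> (frac u - 1 / 2)\<^sup>2" by simp
  moreover have "frac u * frac u \<le> frac u * 1"
    using frac_lt_1[of u] by (intro mult_left_mono) auto
  ultimately show ?thesis by (simp add: power2_eq_square algebra_simps)
qed

text \<open>With a = t/d and y = frac a, the triangular number of a - y is a^2/2 - a (y - 1/2) +
  (y^2 - y)/2. The first terms match the main term up to a tail of the series (error t^2/(2 D)), the
  last are at most 1/8 each, and the 1 comes from the definition. A cutoff D beyond t is allowed so
  that one D serves a whole range of t and sums over d and t can be interchanged.\<close>

lemma E_Delta_approx:
  fixes D :: nat
  assumes "t > 0" "t \<le> real D"
  shows "\<bar>E_Delta t + t * (\<Sum>d=1..D. moebius d / real d * sawtooth (t / real d))\<bar>
           \<le> t\<^sup>2 / (2 * real D) + real D / 8 + 1"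
proof -
  define M where "M = nat \<lfloor>t\<rfloor>"
  have D: "D > 0" using assms by (cases D) auto
  have M: "real m \<le> t \<longleftrightarrow> m \<le> M" for m
    using assms by (simp add: M_def le_nat_iff le_floor_iff)
  have "real M \<le> real D" using M[of M] assms by linarith
  then have MD: "M \<le> D" by simp
  have "{m. 1 \<le> m \<and> real m \<le> t} = {1..M}"
    by (simp only: M atLeastAtMost_def atLeast_def atMost_def Collect_conj_eq)
  then have "(\<Sum>m | 1 \<le> m \<and> real m \<le> t. real (totient m)) =
      (\<Sum>d=1..M. moebius d * (real (M div d) * (real (M div d) + 1) / 2))"
    by (simp only: sum_totient_eq)
  \<comment> \<open>For M < d the quotient M div d is 0, so extending the range up to D is
    free.\<close>
  also have "\<dots> = (\<Sum>d=1..D. moebius d * (real (M div d) * (real (M div d) + 1) / 2))"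
    by (rule sum.mono_neutral_left) (use MD in auto)
  also have "\<dots> = (\<Sum>d=1..D. t\<^sup>2 / 2 * (moebius d / (real d)\<^sup>2)
       - t * (moebius d / real d * sawtooth (t / real d))
       + moebius d * ((frac (t / real d))\<^sup>2 - frac (t / real d)) / 2)"
  proof (intro sum.cong refl)
    fix d assume d: "d \<in> {1..D}"
    have "int (M div d) = \<lfloor>t / real d\<rfloor>"
      using assms floor_divide_real_eq_div[of "int d" t] by (simp add: M_def zdiv_int)
    then have "real (M div d) = of_int \<lfloor>t / real d\<rfloor>"
      by (metis of_int_of_nat_eq)
    then have w: "real (M div d) = t / real d - frac (t / real d)"
      by (simp add: frac_def)
    show "moebius d * (real (M div d) * (real (M div d) + 1) / 2) =
       t\<^sup>2 / 2 * (moebius d / (real d)\<^sup>2) - t * (moebius d / real d * sawtooth (t / real d))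
       + moebius d * ((frac (t / real d))\<^sup>2 - frac (t / real d)) / 2"
      unfolding w sawtooth_def using d by (simp add: field_simps power2_eq_square)
  qed
  also have "\<dots> = t\<^sup>2 / 2 * (\<Sum>d=1..D. moebius d / (real d)\<^sup>2)
      - t * (\<Sum>d=1..D. moebius d / real d * sawtooth (t / real d))
      + (\<Sum>d=1..D. moebius d * ((frac (t / real d))\<^sup>2 - frac (t / real d)) / 2)"
    by (simp add: sum.distrib sum_subtractf sum_distrib_left)
  finally have *: "E_Delta t + t * (\<Sum>d=1..D. moebius d / real d * sawtooth (t / real d)) =
     - (t\<^sup>2 / 2 * (6 / pi\<^sup>2 - (\<Sum>d=1..D. moebius d / (real d)\<^sup>2)))
      + (\<Sum>d=1..D. moebius d * ((frac (t / real d))\<^sup>2 - frac (t / real d)) / 2) + 1"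
    unfolding E_Delta_def by (simp add: algebra_simps)
  have "\<bar>6 / pi\<^sup>2 - (\<Sum>d=1..D. moebius d / (real d)\<^sup>2)\<bar> \<le> 1 / real D"
    using moebius_squares_tail[OF D] by (simp add: suminf_moebius_squares)
  then have "\<bar>t\<^sup>2 / 2 * (6 / pi\<^sup>2 - (\<Sum>d=1..D. moebius d / (real d)\<^sup>2))\<bar> \<le> t\<^sup>2 / 2 * (1 / real D)"
    unfolding abs_mult by (intro mult_mono) auto
  moreover have "\<bar>\<Sum>d=1..D. moebius d * ((frac (t / real d))\<^sup>2 - frac (t / real d)) / 2\<bar> \<le> (\<Sum>d=1..D. 1 / 8)"
  proof (rule order_trans[OF sum_abs], rule sum_mono)
    fix d
    have "\<bar>moebius d\<bar> * \<bar>(frac (t / real d))\<^sup>2 - frac (t / real d)\<bar> \<le> 1 * (1 / 4)"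
      by (intro mult_mono abs_moebius_le_1 abs_frac_square_diff_le) auto
    then show "\<bar>moebius d * ((frac (t / real d))\<^sup>2 - frac (t / real d)) / 2\<bar> \<le> 1 / 8"
      by (simp add: abs_mult)
  qed
  moreover have "(\<Sum>d=1..D. 1 / 8) = real D / 8" "t\<^sup>2 / (2 * real D) = t\<^sup>2 / 2 * (1 / real D)"
    by simp_all
  ultimately show ?thesis
    unfolding * by linarith
qed

section \<open>Sawtooth sums along arithmetic progressions\<close>

lemma abs_sawtooth_le: "\<bar>sawtooth u\<bar> \<le> 1 / 2"
  using frac_ge_0[of u] frac_lt_1[of u] unfolding sawtooth_def abs_le_iff by (intro conjI; linarith)

lemma sawtooth_add_of_nat [simp]: "sawtooth (u + of_nat n) = sawtooth u"
  using frac_add_of_int_right[of u "int n"] by (simp add: sawtooth_def)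

lemma sum_lessThan_add:
  fixes h :: "nat \<Rightarrow> 'a::comm_monoid_add"
  shows "sum h {..<m + n} = sum h {..<m} + (\<Sum>k<n. h (m + k))"
  by (induction n) (auto simp: ac_simps)

text \<open>As u is invertible modulo v, the points k u/v + \<beta> modulo 1 are exactly (j +
  \<delta>)/v for 0 <= j < v, where \<delta> is the fractional part of v \<beta>. This is the
  multiplication formula of the first Bernoulli polynomial.\<close>

lemma sum_sawtooth_period:
  fixes u v :: nat
  assumes "coprime u v" "v > 0"
  shows "(\<Sum>k<v. sawtooth (real k * real u / real v + \<beta>)) = sawtooth (real v * \<beta>)"
proof -
  define m where "m = \<lfloor>real v * \<beta>\<rfloor>"
  define \<delta> where "\<delta> = frac (real v * \<beta>)"
  have \<delta>: "0 \<le> \<delta>" "\<delta> < 1" by (auto simp: \<delta>_def frac_lt_1)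
  have \<beta>: "\<beta> = (of_int m + \<delta>) / real v"
    using assms by (simp add: m_def \<delta>_def frac_def)
  define j where "j k = (int k * int u + m) mod int v" for k :: nat
  have j: "0 \<le> j k" "j k < int v" for k using assms by (auto simp: j_def)
  have "inj_on j {..<v}"
  proof (rule inj_onI)
    fix x y assume xy: "x \<in> {..<v}" "y \<in> {..<v}" "j x = j y"
    then have "[int x * int u + m = int y * int u + m] (mod int v)"
      by (simp add: j_def cong_def)
    then have "[int x * int u = int y * int u] (mod int v)"
      by (simp add: cong_add_rcancel)
    then have "[int x = int y] (mod int v)"
      using assms by (simp add: cong_mult_rcancel)
    then have "[x = y] (mod v)" by (simp add: cong_int_iff)
    with xy show "x = y" by (simp add: cong_less_modulus_unique_nat)
  qed
  moreover have "j ` {..<v} \<subseteq> {0..<int v}" using j by auto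
  ultimately have "j ` {..<v} = {0..<int v}"
    by (intro card_subset_eq) (auto simp: card_image)
  then have "(\<Sum>k<v. real_of_int (j k)) = (\<Sum>i\<in>{0..<int v}. real_of_int i)"
    using \<open>inj_on j {..<v}\<close> by (metis (no_types, lifting) sum.reindex_cong)
  also have "\<dots> = (\<Sum>i<v. real i)"
    by (rule sum.reindex_bij_witness[of _ int nat]) auto
  also have "\<dots> = real v * (real v - 1) / 2"
    by (induction v) (auto simp: field_simps)
  finally have sum_j: "(\<Sum>k<v. real_of_int (j k)) = real v * (real v - 1) / 2" .
  have "sawtooth (real k * real u / real v + \<beta>) = (of_int (j k) + \<delta>) / real v - 1 / 2" for k
  proof -
    have "frac (real k * real u / real v + \<beta>) = (of_int (j k) + \<delta>) / real v"
    proof (subst frac_unique_iff, intro conjI)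
      have "real k * real u + of_int m = of_int (int k * int u + m)" by simp
      also have "\<dots> = of_int ((int k * int u + m) div int v) * real v + of_int (j k)"
        unfolding j_def by (metis div_mult_mod_eq of_int_add of_int_mult of_int_of_nat_eq)
      finally have "real k * real u / real v + \<beta> - (of_int (j k) + \<delta>) / real v
          = of_int ((int k * int u + m) div int v)"
        using assms by (simp add: \<beta> divide_simps)
      then show "real k * real u / real v + \<beta> - (of_int (j k) + \<delta>) / real v \<in> \<int>" by simp
      show "0 \<le> (of_int (j k) + \<delta>) / real v" using j[of k] \<delta> by simp
      have "of_int (j k) \<le> real v - 1" using j(2)[of k] by linarith
      then show "(of_int (j k) + \<delta>) / real v < 1" using \<delta> assms by simp
    qed
    then show ?thesis by (simp add: sawtooth_def)
  qed
  then have "(\<Sum>k<v. sawtooth (real k * real u / real v + \<beta>)) =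
     (\<Sum>k<v. real_of_int (j k)) / real v + \<delta> - real v / 2"
    using assms by (simp add: sum_subtractf add_divide_distrib sum.distrib sum_divide_distrib)
  also have "\<dots> = sawtooth (real v * \<beta>)"
    using assms by (simp add: sum_j sawtooth_def \<delta>_def field_simps)
  finally show ?thesis .
qed

text \<open>Full periods agree exactly with the proposed mean by \<open>sum_sawtooth_period\<close>.
  Only an incomplete period of fewer than v terms is left, with all values at most 1/2 in
  size.\<close>

lemma sum_sawtooth_rational_step:
  fixes u v N :: nat
  assumes "coprime u v" "v > 0"
  shows "\<bar>(\<Sum>k<N. sawtooth (real k * real u / real v + \<beta>)) - real N / real v * sawtooth (real v * \<beta>)\<bar> \<le> real v"
proof (induction N rule: less_induct)
  case (less N)
  show ?case
  proof (cases "N < v")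
    case True
    have "\<bar>\<Sum>k<N. sawtooth (real k * real u / real v + \<beta>)\<bar> \<le> (\<Sum>k<N. 1 / 2)"
      by (rule order_trans[OF sum_abs], rule sum_mono, rule abs_sawtooth_le)
    also have "\<dots> = real N / 2" by simp
    finally have "\<bar>\<Sum>k<N. sawtooth (real k * real u / real v + \<beta>)\<bar> \<le> real N / 2" .
    moreover have "\<bar>real N / real v * sawtooth (real v * \<beta>)\<bar> \<le> 1 * (1 / 2)"
      unfolding abs_mult using True by (intro mult_mono abs_sawtooth_le) auto
    moreover have "real N / 2 + 1 / 2 \<le> real v" using True by linarith
    ultimately show ?thesis by linarith
  next
    case False
    then obtain n where N: "N = v + n" using le_Suc_ex not_less by blast
    have shift: "sawtooth (real (v + k) * real u / real v + \<beta>) = sawtooth (real k * real u / real v + \<beta>)" for k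
    proof -
      have "real (v + k) * real u / real v + \<beta> = (real k * real u / real v + \<beta>) + real u"
        using assms by (simp add: field_simps)
      then show ?thesis by (simp only: sawtooth_add_of_nat)
    qed
    have "(\<Sum>k<N. sawtooth (real k * real u / real v + \<beta>)) =
       sawtooth (real v * \<beta>) + (\<Sum>k<n. sawtooth (real k * real u / real v + \<beta>))"
      unfolding N sum_lessThan_add shift sum_sawtooth_period[OF assms] ..
    moreover have "real N / real v * sawtooth (real v * \<beta>) =
       sawtooth (real v * \<beta>) + real n / real v * sawtooth (real v * \<beta>)"
      using assms by (simp add: N add_divide_distrib distrib_right)
    ultimately show ?thesis using less.IH[of n] assms by (simp add: N)
  qed
qed

text \<open>For a small step the sum is compared with the integral: \<open>(frac u)\<^sup>2 / 2 - frac u / 2\<close> is a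
  continuous antiderivative of the sawtooth, and each jump of the sawtooth costs one step length.\<close>

lemma sum_sawtooth_small_step:
  fixes N :: nat
  assumes "0 < \<theta>" "\<theta> < 1"
  shows "\<bar>\<Sum>k<N. sawtooth (real k * \<theta> + \<beta>)\<bar> \<le> 2 / \<theta> + 2 * real N * \<theta>"
proof -
  define \<Psi> where "\<Psi> u = ((frac u)\<^sup>2 - frac u) / 2" for u :: real
  have \<Psi>: "\<bar>\<Psi> u\<bar> \<le> 1 / 2" for u
    using abs_frac_square_diff_le[of u] by (simp add: \<Psi>_def)
  \<comment> \<open>Since \<theta> < 1, a step crosses at most one integer, and the difference of
    floors records whether it does. These differences telescope, so all jumps together cost at most
    \<theta> (N \<theta> + 1).\<close>
  have step: "\<bar>\<theta> * sawtooth u - (\<Psi> (u + \<theta>) - \<Psi> u)\<bar> \<le> \<theta>\<^sup>2 / 2 + \<theta> * (of_int \<lfloor>u + \<theta>\<rfloor> - of_int \<lfloor>u\<rfloor>)" for u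
  proof (cases "frac u + \<theta> < 1")
    case True
    then have fr: "frac (u + \<theta>) = frac u + \<theta>" and fl: "\<lfloor>u + \<theta>\<rfloor> = \<lfloor>u\<rfloor>"
      using assms by (simp_all add: frac_add floor_add frac_eq_id floor_eq_iff)
    have "\<theta> * sawtooth u - (\<Psi> (u + \<theta>) - \<Psi> u) = - (\<theta>\<^sup>2 / 2)"
      unfolding \<Psi>_def fr sawtooth_def by (simp add: field_simps power2_eq_square)
    then show ?thesis by (simp add: fl)
  next
    case False
    then have fr: "frac (u + \<theta>) = frac u + \<theta> - 1" and fl: "\<lfloor>u + \<theta>\<rfloor> = \<lfloor>u\<rfloor> + 1"
      using assms by (simp_all add: frac_add floor_add frac_eq_id floor_eq_iff)
    have "\<theta> * sawtooth u - (\<Psi> (u + \<theta>) - \<Psi> u) = (frac u + \<theta> - 1) - \<theta>\<^sup>2 / 2"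
      unfolding \<Psi>_def fr sawtooth_def by (simp add: field_simps power2_eq_square)
    moreover have "0 \<le> frac u + \<theta> - 1" "frac u + \<theta> - 1 \<le> \<theta>"
      using False frac_lt_1[of u] by auto
    moreover have "\<theta> * (of_int (\<lfloor>u\<rfloor> + 1) - of_int \<lfloor>u\<rfloor>) = \<theta>" "0 \<le> \<theta>\<^sup>2 / 2" by simp_all
    ultimately show ?thesis unfolding fl by linarith
  qed
  have "\<bar>\<theta> * (\<Sum>k<N. sawtooth (real k * \<theta> + \<beta>)) - (\<Psi> (real N * \<theta> + \<beta>) - \<Psi> \<beta>)\<bar>
     \<le> real N * \<theta>\<^sup>2 / 2 + \<theta> * (of_int \<lfloor>real N * \<theta> + \<beta>\<rfloor> - of_int \<lfloor>\<beta>\<rfloor>)"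
  proof (induction N)
    case (Suc N)
    have eq: "real (Suc N) * \<theta> + \<beta> = (real N * \<theta> + \<beta>) + \<theta>" by (simp add: algebra_simps)
    show ?case
      using Suc step[of "real N * \<theta> + \<beta>"] unfolding eq
      by (simp add: algebra_simps add_divide_distrib)
  qed simp
  moreover have "\<theta> * (of_int \<lfloor>real N * \<theta> + \<beta>\<rfloor> - of_int \<lfloor>\<beta>\<rfloor>) \<le> \<theta> * (real N * \<theta> + 1)"
    using assms by (intro mult_left_mono) linarith+
  ultimately have "\<bar>\<theta> * (\<Sum>k<N. sawtooth (real k * \<theta> + \<beta>))\<bar> \<le> 1 + real N * \<theta>\<^sup>2 / 2 + \<theta> * (real N * \<theta> + 1)"
    using \<Psi>[of "real N * \<theta> + \<beta>"] \<Psi>[of \<beta>] by (simp add: abs_le_iff) linarith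
  also have "\<dots> \<le> 2 + 2 * real N * \<theta>\<^sup>2"
  proof -
    have "\<theta> * (real N * \<theta> + 1) = real N * \<theta>\<^sup>2 + \<theta>"
      by (simp add: algebra_simps power2_eq_square)
    moreover have "0 \<le> real N * \<theta>\<^sup>2" by simp
    ultimately show ?thesis using assms by linarith
  qed
  also have "\<dots> = \<theta> * (2 / \<theta> + 2 * real N * \<theta>)"
    using assms by (simp add: field_simps power2_eq_square)
  finally show ?thesis
    using assms by (simp add: abs_mult)
qed

section \<open>Primes congruent to 3 modulo 4\<close>

definition chi4 :: "nat \<Rightarrow> real" where
  "chi4 n = (if n mod 4 = 1 then 1 else if n mod 4 = 3 then -1 else 0)"

lemma chi4_mult: "chi4 (m * n) = chi4 m * chi4 n"
proof -
  have *: "(m * n) mod 4 = ((m mod 4) * (n mod 4)) mod 4"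
    by (simp add: mod_mult_eq)
  have "m mod 4 \<in> {0, 1, 2, 3}" "n mod 4 \<in> {0, 1, 2, 3}" by auto
  then show ?thesis
    unfolding chi4_def * by auto
qed

lemma odd_mod_4_cases:
  fixes n :: nat
  assumes "odd n"
  shows "n mod 4 = 1 \<or> n mod 4 = 3"
  using assms by presburger

text \<open>This is where the character enters: at odd quarters the sawtooth becomes multiplicative
  in the numerator, up to the factor -1/4.\<close>

lemma sawtooth_quarter:
  assumes "odd n"
  shows "sawtooth (real n / 4) = - chi4 n / 4"
proof -
  have "real n / 4 = real (n mod 4) / 4 + real (n div 4)"
    using mod_mult_div_eq[of n 4] by (metis (no_types, opaque_lifting) add_divide_distrib nonzero_mult_div_cancel_left of_nat_add of_nat_mult of_nat_numeral zero_neq_numeral)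
  then have "sawtooth (real n / 4) = sawtooth (real (n mod 4) / 4)"
    by (simp only: sawtooth_add_of_nat)
  then show ?thesis
    using odd_mod_4_cases[OF assms] by (auto simp: sawtooth_def chi4_def frac_eq_id)
qed

text \<open>The sums are those of the alternating series 1 - 1/3 + 1/5 - ..., which stay between 0
  and 1.\<close>

lemma sum_chi4_bound: "\<bar>\<Sum>k=1..n. chi4 k / real k\<bar> \<le> 1"
proof -
  define f where "f n = (\<Sum>k=1..n. chi4 k / real k)" for n
  have f_Suc: "f (Suc n) = f n + chi4 (Suc n) / real (Suc n)" for n
    by (simp add: f_def)
  have chi: "chi4 (Suc (4 * m)) = 1" "chi4 (Suc (Suc (4 * m))) = 0"
    "chi4 (Suc (Suc (Suc (4 * m)))) = -1" "chi4 (Suc (Suc (Suc (Suc (4 * m))))) = 0" for m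
    unfolding chi4_def by (simp_all add: mod_Suc)
  have f4: "f (Suc (4 * m)) = f (4 * m) + 1 / (4 * real m + 1)"
    "f (Suc (Suc (4 * m))) = f (4 * m) + 1 / (4 * real m + 1)"
    "f (Suc (Suc (Suc (4 * m)))) = f (4 * m) + 1 / (4 * real m + 1) - 1 / (4 * real m + 3)"
    "f (Suc (Suc (Suc (Suc (4 * m))))) = f (4 * m) + 1 / (4 * real m + 1) - 1 / (4 * real m + 3)" for m
    by (simp_all add: f_Suc chi add_ac)
  have dec: "1 / (4 * real m + 3) \<le> 1 / (4 * real m + 1)" "1 / (4 * real m + 5) \<le> 1 / (4 * real m + 3)" for m
    by (simp_all add: divide_simps)
  \<comment> \<open>Within a block of four the largest partial sum occurs right after its first
    term, so the invariant bounds that value from above.\<close>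
  have block: "0 \<le> f (4 * m) \<and> f (4 * m) + 1 / (4 * real m + 1) \<le> 1" for m
  proof (induction m)
    case (Suc m)
    have "4 * Suc m = Suc (Suc (Suc (Suc (4 * m))))" by simp
    then show ?case using Suc dec[of m] by (simp only: f4) (simp add: add_ac)
  qed (simp add: f_def)
  have pos: "0 \<le> 1 / (4 * real m + 1)" "0 \<le> 1 / (4 * real m + 3)" for m by simp_all
  have le1: "f (4 * m) \<le> 1" for m
    using block[of m] pos(1)[of m] by linarith
  have le3: "f (4 * m) + 1 / (4 * real m + 1) - 1 / (4 * real m + 3) \<le> 1" for m
    using block[of m] pos(2)[of m] by linarith
  have "n = 4 * (n div 4) \<or> n = Suc (4 * (n div 4)) \<or> n = Suc (Suc (4 * (n div 4)))
      \<or> n = Suc (Suc (Suc (4 * (n div 4))))"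
    by presburger
  then consider m where "n = 4 * m" | m where "n = Suc (4 * m)" | m where "n = Suc (Suc (4 * m))"
    | m where "n = Suc (Suc (Suc (4 * m)))"
    by blast
  then have "0 \<le> f n \<and> f n \<le> 1"
  proof cases
    case (1 m) then show ?thesis using block[of m] pos[of m] le1[of m] le3[of m] by auto
  next
    case (2 m) then show ?thesis using block[of m] pos[of m] by (auto simp: f4)
  next
    case (3 m) then show ?thesis using block[of m] pos[of m] by (auto simp: f4)
  next
    case (4 m) then show ?thesis using block[of m] pos[of m] dec[of m] le3[of m] by (auto simp: f4)
  qed
  then show ?thesis by (simp add: f_def)
qed

text \<open>In terms of Dirichlet series the passage from \<open>g\<close> to \<open>g'\<close> multiplies by
  \<open>(1 + p\<^sup>-\<^sup>s) / (1 - p\<^sup>-\<^sup>s)\<close>.\<close>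

lemma partial_sums_flip_prime:
  fixes g g' :: "nat \<Rightarrow> real"
  assumes p: "p > 1"
    and g: "\<And>n. g (p * n) = - g n" and g': "\<And>n. g' (p * n) = g' n"
    and eq: "\<And>n. \<not> p dvd n \<Longrightarrow> g' n = g n"
    and bound: "\<And>x. \<bar>\<Sum>n=1..x. g n / real n\<bar> \<le> M"
  shows "\<bar>\<Sum>n=1..x. g' n / real n\<bar> \<le> M * ((1 + 1 / real p) / (1 - 1 / real p))"
proof (induction x rule: less_induct)
  case (less x)
  define K where "K = M * ((1 + 1 / real p) / (1 - 1 / real p))"
  have "0 \<le> M" using bound[of 0] by simp
  then have K0: "0 \<le> K" using p by (simp add: K_def)
  \<comment> \<open>K is the fixed point of the recursion that bounds the sum up to x by means of
    the sum up to x div p.\<close>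
  have K: "M + (M + K) / real p = K"
    using p by (simp add: K_def field_simps)
  \<comment> \<open>Only multiples p e contribute to the difference, and there g' - g takes the
    value g'(e) + g(e).\<close>
  have "(\<Sum>n=1..x. g' n / real n) - (\<Sum>n=1..x. g n / real n) = (\<Sum>n=1..x. (g' n - g n) / real n)"
    by (simp add: sum_subtractf diff_divide_distrib)
  also have "\<dots> = (\<Sum>n\<in>{n\<in>{1..x}. p dvd n}. (g' n - g n) / real n)"
    by (rule sum.mono_neutral_right) (use eq in auto)
  also have "\<dots> = (\<Sum>e=1..x div p. (g' (p * e) - g (p * e)) / real (p * e))"
    by (rule sum_multiples) (use p in auto)
  also have "\<dots> = ((\<Sum>e=1..x div p. g' e / real e) + (\<Sum>e=1..x div p. g e / real e)) / real p"
    unfolding g g' by (simp add: sum.distrib sum_divide_distrib add_divide_distrib mult.commute)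
  finally have eq': "(\<Sum>n=1..x. g' n / real n) = (\<Sum>n=1..x. g n / real n) +
      ((\<Sum>e=1..x div p. g' e / real e) + (\<Sum>e=1..x div p. g e / real e)) / real p" by simp
  have small: "\<bar>\<Sum>e=1..x div p. g' e / real e\<bar> \<le> K"
  proof (cases "x = 0")
    case False
    then have "x div p < x" using p by simp
    then show ?thesis using less unfolding K_def by blast
  qed (use K0 in simp)
  have "\<bar>((\<Sum>e=1..x div p. g' e / real e) + (\<Sum>e=1..x div p. g e / real e)) / real p\<bar> \<le> (M + K) / real p"
    using small bound[of "x div p"] by (simp add: divide_right_mono)
  then have "\<bar>\<Sum>n=1..x. g' n / real n\<bar> \<le> M + (M + K) / real p"
    unfolding eq' using bound[of x] by linarith
  then show ?case unfolding K by (simp add: K_def)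
qed

text \<open>The primes of S are treated one at a time, starting from \<open>chi4\<close>; each
  application of \<open>partial_sums_flip_prime\<close> contributes one factor of the
  product.\<close>

lemma exists_flipped_chi4:
  assumes "finite S" "\<And>p. p \<in> S \<Longrightarrow> prime p \<and> p mod 4 = 3"
  shows "\<exists>g. g 1 = 1 \<and> (\<forall>m n. g (m * n) = g m * g n) \<and>
     (\<forall>p. prime p \<longrightarrow> g p = (if p \<in> S then 1 else chi4 p)) \<and>
     (\<forall>x. \<bar>\<Sum>n=1..x. g n / real n\<bar> \<le> (\<Prod>p\<in>S. (1 + 1 / real p) / (1 - 1 / real p)))"
  using assms
proof (induction S rule: finite_induct)
  case empty
  have "chi4 1 = 1" by (simp add: chi4_def)
  then show ?case using sum_chi4_bound chi4_mult by (intro exI[of _ chi4]) simp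
next
  case (insert p S)
  then obtain g where g1: "g 1 = 1" and gm: "\<And>m n. g (m * n) = g m * g n"
    and gp: "\<And>p. prime p \<Longrightarrow> g p = (if p \<in> S then 1 else chi4 p)"
    and gb: "\<And>x. \<bar>\<Sum>n=1..x. g n / real n\<bar> \<le> (\<Prod>p\<in>S. (1 + 1 / real p) / (1 - 1 / real p))"
    by auto
  have p: "prime p" "p mod 4 = 3" using insert by auto
  then have g_p: "g p = -1" using gp[of p] insert by (simp add: chi4_def)
  have g0: "g 0 = 0" using gm[of 0 p] g_p by simp
  \<comment> \<open>The factor changes the value at p from -1 to 1 and keeps complete
    multiplicativity. At 0, where multiplicities do not add, multiplicativity rests on
    \<open>g0\<close>.\<close>
  define g' where "g' n = g n * (-1) ^ multiplicity p n" for n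
  have g'm: "g' (m * n) = g' m * g' n" for m n
  proof (cases "m = 0 \<or> n = 0")
    case False
    then show ?thesis
      using p by (simp add: g'_def gm prime_elem_multiplicity_mult_distrib power_add)
  qed (auto simp: g'_def g0)
  have g'p: "g' p = 1" using p g_p by (simp add: g'_def)
  have "\<bar>\<Sum>n=1..x. g' n / real n\<bar> \<le> (\<Prod>p\<in>S. (1 + 1 / real p) / (1 - 1 / real p)) * ((1 + 1 / real p) / (1 - 1 / real p))" for x
  proof (rule partial_sums_flip_prime[where g = g and p = p])
    show "1 < p" using p by (simp add: prime_gt_1_nat)
    show "g (p * n) = - g n" for n by (simp add: gm g_p)
    show "g' (p * n) = g' n" for n by (simp add: g'm g'p)
    show "g' n = g n" if "\<not> p dvd n" for n using that by (simp add: g'_def not_dvd_imp_multiplicity_0)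
  qed (rule gb)
  moreover have "g' q = (if q \<in> insert p S then 1 else chi4 q)" if "prime q" for q
  proof (cases "q = p")
    case False
    then have "\<not> p dvd q" using that p primes_dvd_imp_eq by blast
    then show ?thesis using False gp[OF that] by (simp add: g'_def not_dvd_imp_multiplicity_0)
  qed (simp add: g'p)
  moreover have "g' 1 = 1" using g1 by (simp add: g'_def)
  ultimately show ?case
    using g'm insert by (intro exI[of _ g']) (simp add: mult.commute)
qed

text \<open>A Mertens-type bound. After all these primes are flipped, g is 1 at every prime factor
  of an odd n <= 2 m and 0 at 2. Its weighted sum up to 2 m is therefore the sum of 1/n over odd n,
  at least half of \<open>harm m\<close>.\<close>

lemma prod_primes_3_mod_4_ratio:
  defines "S \<equiv> \<lambda>m::nat. {p. prime p \<and> p \<le> 2 * m \<and> p mod 4 = 3}"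
  shows "ln (real m + 1) / 2 \<le> (\<Prod>p\<in>S m. (1 + 1 / real p) / (1 - 1 / real p))"
proof -
  have fin: "finite (S m)" unfolding S_def by (rule finite_subset[of _ "{..2 * m}"]) auto
  obtain g where g1: "g 1 = 1" and gm: "\<And>m n. g (m * n) = g m * g n"
    and gp: "\<And>p. prime p \<Longrightarrow> g p = (if p \<in> S m then 1 else chi4 p)"
    and gb: "\<And>x. \<bar>\<Sum>n=1..x. g n / real n\<bar> \<le> (\<Prod>p\<in>S m. (1 + 1 / real p) / (1 - 1 / real p))"
    using exists_flipped_chi4[OF fin] unfolding S_def by auto
  have "g 2 = 0" using gp[of 2] by (simp add: S_def chi4_def)
  then have g_even: "g (2 * n) = 0" for n by (simp add: gm)
  have g_odd: "g n = 1" if "odd n" "n \<le> 2 * m" for n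
    using that
  proof (induction n rule: less_induct)
    case (less n)
    show ?case
    proof (cases "n = 1")
      case False
      then obtain q where q: "prime q" "q dvd n" using prime_factor_nat by blast
      then obtain k where k: "n = q * k" by auto
      have "n > 0" using less.prems by (auto intro: Nat.gr0I)
      then have "k < n" "q \<le> n" using q k by (auto simp: prime_gt_Suc_0_nat dvd_imp_le)
      moreover have "odd q" "odd k" using less.prems k by auto
      ultimately have "g k = 1" "g q = 1"
        using less q odd_mod_4_cases[of q] by (auto simp: gp S_def chi4_def)
      then show ?thesis by (simp add: k gm)
    qed (use g1 in simp)
  qed
  have "harm k / 2 \<le> (\<Sum>n=1..2 * k. g n / real n)" if "k \<le> m" for k
    using that
  proof (induction k)
    case (Suc k)
    have "(\<Sum>n=1..2 * Suc k. g n / real n) = (\<Sum>n=1..2 * k. g n / real n) + 1 / real (2 * k + 1)"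
      using g_odd[of "Suc (2 * k)"] g_even[of "Suc k"] Suc.prems by simp
    moreover have "inverse (real (Suc k)) / 2 \<le> 1 / real (2 * k + 1)"
      by (simp add: divide_simps)
    ultimately show ?case using Suc by (simp add: harm_Suc add_divide_distrib)
  qed (simp add: harm_def)
  from this[of m] have "harm m / 2 \<le> (\<Prod>p\<in>S m. (1 + 1 / real p) / (1 - 1 / real p))"
    using gb[of "2 * m"] by linarith
  then show ?thesis using harm_ge_ln[of m] by linarith
qed

text \<open>Over all n from 2 to N the product telescopes to (N+1)/(2 N); leaving out factors that
  lie between 0 and 1 can only increase it.\<close>

lemma prod_one_minus_inverse_squares_ge:
  fixes A :: "nat set"
  assumes "finite A" "\<And>n. n \<in> A \<Longrightarrow> 2 \<le> n"
  shows "1 / 2 \<le> (\<Prod>n\<in>A. 1 - 1 / (real n)\<^sup>2)"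
proof -
  obtain N0 where "\<forall>n\<in>A. n \<le> N0"
    using assms(1) finite_nat_set_iff_bounded_le by blast
  then have "A \<subseteq> {2..Suc N0}" using assms(2) by fastforce
  then obtain N where N: "A \<subseteq> {2..N}" "N \<ge> 1"
    using that[of "Suc N0"] by auto
  have fac: "0 \<le> 1 - 1 / (real n)\<^sup>2" "1 - 1 / (real n)\<^sup>2 \<le> 1" if "2 \<le> n" for n
    using that by (auto simp: divide_simps)
  have "(\<Prod>n=2..N. 1 - 1 / (real n)\<^sup>2) = (real N + 1) / (2 * real N)"
    using N(2)
  proof (induction N rule: dec_induct)
    case (step n)
    have "1 - 1 / x\<^sup>2 = (x - 1) * (x + 1) / x\<^sup>2" if "x \<noteq> 0" for x :: real
      using that by (simp add: field_simps power2_eq_square)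
    from this[of "real (Suc n)"]
    have "1 - 1 / (real (Suc n))\<^sup>2 = real n * (real n + 2) / (real n + 1)\<^sup>2"
      by (simp add: add_ac)
    moreover have "(1 + x) / (2 * x) * (x * (x + 2) / (1 + x)\<^sup>2) = (x + 2) / (2 + 2 * x)"
      if "x > 0" for x :: real
      using that by (simp add: divide_simps power2_eq_square)
    from this[of "real n"] have "(1 + real n) / (2 * real n) * (real n * (real n + 2) / (1 + real n)\<^sup>2)
        = (real n + 2) / (2 + 2 * real n)"
      using step by simp
    ultimately show ?case using step by (simp add: add_ac)
  qed simp
  moreover have "1 / 2 \<le> (real N + 1) / (2 * real N)"
    using N(2) by (simp add: divide_simps)
  ultimately have "1 / 2 \<le> (\<Prod>n=2..N. 1 - 1 / (real n)\<^sup>2)"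
    by simp
  also have "\<dots> = (\<Prod>n\<in>{2..N} - A. 1 - 1 / (real n)\<^sup>2) * (\<Prod>n\<in>A. 1 - 1 / (real n)\<^sup>2)"
    using N(1) by (intro prod.subset_diff) auto
  also have "\<dots> \<le> 1 * (\<Prod>n\<in>A. 1 - 1 / (real n)\<^sup>2)"
  proof (intro mult_right_mono prod_le_1 prod_nonneg)
    show "0 \<le> 1 - 1 / (real n)\<^sup>2" if "n \<in> A" for n
      using fac(1) assms(2) that by blast
  qed (use fac in auto)
  finally show ?thesis by simp
qed

text \<open>The identity (1+1/p)^2 = (1+1/p)/(1-1/p) * (1-1/p^2) bounds the square of the full
  product below by ln(m+1)/4. Omitting the primes that divide B costs at most the constant factor
  K.\<close>

lemma prod_primes_3_mod_4_ge:
  fixes B :: nat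
  assumes "B > 0"
  defines "S \<equiv> \<lambda>m::nat. {p. prime p \<and> p \<le> 2 * m \<and> p mod 4 = 3 \<and> \<not> p dvd B}"
  shows "\<exists>c>0. \<forall>m. c * sqrt (ln (real m + 1)) \<le> (\<Prod>p\<in>S m. 1 + 1 / real p)"
proof (intro exI conjI allI)
  define K where "K = (\<Prod>p\<in>prime_factors B. 1 + 1 / real p)"
  have K: "K > 0" unfolding K_def by (rule prod_pos) (simp add: add_pos_nonneg)
  show "1 / (2 * K) > 0" using K by simp
  fix m :: nat
  define T where "T = {p. prime p \<and> p \<le> 2 * m \<and> p mod 4 = 3}"
  have fin: "finite T" unfolding T_def by (rule finite_subset[of _ "{..2 * m}"]) auto
  have T2: "2 \<le> p" if "p \<in> T" for p using that by (simp add: T_def prime_ge_2_nat)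
  let ?Q = "\<Prod>p\<in>T. 1 + 1 / real p"
  have Q0: "0 \<le> ?Q" by (rule prod_nonneg) simp
  have "?Q ^ 2 = (\<Prod>p\<in>T. (1 + 1 / real p) / (1 - 1 / real p)) * (\<Prod>p\<in>T. 1 - 1 / (real p)\<^sup>2)"
    unfolding prod.distrib[symmetric] power2_eq_square[of ?Q]
  proof (intro prod.cong refl)
    fix p assume "p \<in> T"
    then have "real p \<noteq> 0" "1 - 1 / real p \<noteq> 0" using T2[of p] by auto
    then have "(1 + 1 / real p) * (1 + 1 / real p) * (1 - 1 / real p) = (1 + 1 / real p) * (1 - 1 / (real p)\<^sup>2)"
      by (simp add: field_simps power2_eq_square)
    then show "(1 + 1 / real p) * (1 + 1 / real p) = (1 + 1 / real p) / (1 - 1 / real p) * (1 - 1 / (real p)\<^sup>2)"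
      using \<open>1 - 1 / real p \<noteq> 0\<close> by (simp add: divide_simps mult.commute)
  qed
  also have "\<dots> \<ge> ln (real m + 1) / 2 * (1 / 2)"
  proof (intro mult_mono)
    show "ln (real m + 1) / 2 \<le> (\<Prod>p\<in>T. (1 + 1 / real p) / (1 - 1 / real p))"
      unfolding T_def by (rule prod_primes_3_mod_4_ratio)
    show "1 / 2 \<le> (\<Prod>p\<in>T. 1 - 1 / (real p)\<^sup>2)"
      using fin T2 by (rule prod_one_minus_inverse_squares_ge)
    show "0 \<le> (\<Prod>p\<in>T. (1 + 1 / real p) / (1 - 1 / real p))"
      by (rule prod_nonneg) (use T2 in fastforce)
  qed simp
  finally have "sqrt (ln (real m + 1) / 4) \<le> ?Q"
    using Q0 by (simp add: real_le_lsqrt)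
  then have Q: "sqrt (ln (real m + 1)) / 2 \<le> ?Q"
    by (simp add: real_sqrt_divide)
  have "?Q = (\<Prod>p\<in>T - {p\<in>T. p dvd B}. 1 + 1 / real p) * (\<Prod>p\<in>{p\<in>T. p dvd B}. 1 + 1 / real p)"
    using fin by (intro prod.subset_diff) auto
  also have "T - {p\<in>T. p dvd B} = S m" by (auto simp: T_def S_def)
  also have "(\<Prod>p\<in>S m. 1 + 1 / real p) * (\<Prod>p\<in>{p\<in>T. p dvd B}. 1 + 1 / real p) \<le> (\<Prod>p\<in>S m. 1 + 1 / real p) * K"
    unfolding K_def using assms
    by (intro mult_left_mono prod_mono2 prod_nonneg) (auto simp: T_def prime_factors_dvd)
  finally have "sqrt (ln (real m + 1)) / 2 \<le> (\<Prod>p\<in>S m. 1 + 1 / real p) * K"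
    using Q by linarith
  then show "1 / (2 * K) * sqrt (ln (real m + 1)) \<le> (\<Prod>p\<in>S m. 1 + 1 / real p)"
    using K by (simp add: field_simps)
qed

section \<open>Averages along progressions\<close>

lemma chi4_1 [simp]: "chi4 (Suc 0) = 1" and chi4_3 [simp]: "chi4 3 = -1"
  by (simp_all add: chi4_def)

lemma chi4_add_mult_4 [simp]: "chi4 (4 * m + n) = chi4 n"
  by (simp add: chi4_def)

text \<open>Both functions are -1 at each prime of S, and g is a product of distinct such primes.
  Replacing the character by \<open>moebius\<close> is what lines up the signs of the dominant
  terms.\<close>

lemma chi4_eq_moebius:
  assumes "finite S" "\<And>p. p \<in> S \<Longrightarrow> prime p \<and> p mod 4 = 3" "g dvd \<Prod>S"
  shows "chi4 g = moebius g \<and> \<bar>moebius g\<bar> = 1"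
  using assms
proof (induction S arbitrary: g rule: finite_induct)
  case (insert p S)
  have p: "prime p" "p mod 4 = 3" using insert by auto
  have pS: "\<not> p dvd \<Prod>S"
  proof
    assume "p dvd \<Prod>S"
    then obtain q where "q \<in> S" "p dvd q"
      using p insert.hyps by (auto simp: prime_dvd_prod_iff)
    then show False using insert p primes_dvd_imp_eq by blast
  qed
  show ?case
  proof (cases "p dvd g")
    case True
    then obtain h where h: "g = p * h" by auto
    have "h dvd \<Prod>S"
      using insert.prems insert.hyps p by (simp add: h)
    moreover from this have "\<not> p dvd h" using pS dvd_trans by blast
    moreover have "chi4 p = -1" using p by (simp add: chi4_def)
    ultimately show ?thesis
      using insert.IH[of h] insert.prems p by (simp add: h chi4_mult moebius_prime_mult)
  next
    case False
    then have "coprime g p" using p prime_imp_coprime coprime_commute by blast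
    then have "g dvd \<Prod>S"
      using insert.prems insert.hyps by (simp add: coprime_dvd_mult_right_iff)
    then show ?thesis using insert.IH[of g] insert.prems by simp
  qed
qed simp

text \<open>Expanding the product yields 1/g for each divisor g. In the induction, the divisors
  without the new prime p and their multiples by p form disjoint families.\<close>

lemma prod_le_sum_inverse_divisors:
  assumes "finite S" "\<And>p. p \<in> S \<Longrightarrow> prime p"
  shows "(\<Prod>p\<in>S. 1 + 1 / real p) \<le> (\<Sum>g | g dvd \<Prod>S. 1 / real g)"
  using assms
proof (induction S rule: finite_induct)
  case (insert p S)
  have p: "prime p" using insert by auto
  have pos: "\<Prod>S > 0" using insert by (auto intro!: prod_pos simp: prime_gt_0_nat)
  have pS: "\<not> p dvd \<Prod>S"
  proof
    assume "p dvd \<Prod>S"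
    then obtain q where "q \<in> S" "p dvd q"
      using p insert.hyps by (auto simp: prime_dvd_prod_iff)
    then show False using insert p primes_dvd_imp_eq by blast
  qed
  let ?D = "{g. g dvd \<Prod>S}"
  have fin: "finite ?D" using pos by simp
  have disj: "?D \<inter> (*) p ` ?D = {}"
    using pS dvd_trans dvd_triv_left by blast
  have "(\<Prod>q\<in>insert p S. 1 + 1 / real q) = (1 + 1 / real p) * (\<Prod>q\<in>S. 1 + 1 / real q)"
    using insert by simp
  also have "\<dots> \<le> (1 + 1 / real p) * (\<Sum>g\<in>?D. 1 / real g)"
    using insert by (intro mult_left_mono) auto
  also have "\<dots> = (\<Sum>g\<in>?D. 1 / real g) + (\<Sum>g\<in>(*) p ` ?D. 1 / real g)"
    using p by (subst sum.reindex) (auto simp: inj_on_def distrib_right sum_divide_distrib mult.commute)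
  also have "\<dots> = (\<Sum>g\<in>?D \<union> (*) p ` ?D. 1 / real g)"
    using fin disj by (intro sum.union_disjoint[symmetric]) auto
  also have "\<dots> \<le> (\<Sum>g | g dvd \<Prod>(insert p S). 1 / real g)"
  proof (rule sum_mono2)
    have "p * \<Prod>S > 0" using p pos by (simp add: prime_gt_0_nat)
    then show "finite {g. g dvd \<Prod>(insert p S)}" using insert.hyps by simp
  qed (use insert.hyps in \<open>auto intro: dvd_mult\<close>)
  finally show ?case .
qed simp

text \<open>The term 1/4 plus a tail of at most 1/2. A bound below 1 is what lets the term d = g
  outweigh the rest of its gcd class.\<close>

lemma sum_inverse_squares_from_2_le: "(\<Sum>e=2..n. 1 / (real e)\<^sup>2) \<le> 3 / 4"
proof -
  have "(\<Sum>e=2..n. 1 / (real e)\<^sup>2) \<le> (\<Sum>e\<in>insert 2 {2<..n}. 1 / (real e)\<^sup>2)"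
    by (rule sum_mono2) auto
  also have "\<dots> \<le> 1 / 4 + 1 / 2"
    using sum_inverse_squares_le[of 2 n] by simp
  finally show ?thesis by simp
qed

text \<open>The terms are grouped by \<open>g = gcd d P\<close>; within a group the term \<open>d = g\<close> dominates.\<close>

lemma sum_moebius_gcd_ge:
  fixes P :: nat
  assumes P: "P > 0" and mu: "\<And>g. g dvd P \<Longrightarrow> \<bar>moebius g\<bar> = 1"
  shows "(\<Sum>g | g dvd P. 1 / real g) / 4
    \<le> (\<Sum>d=1..P. moebius d * moebius (gcd d P) * real (gcd d P) / (real d)\<^sup>2)"
proof -
  define h where "h d = moebius d * moebius (gcd d P) * real (gcd d P) / (real d)\<^sup>2" for d
  have "1 / real g / 4 \<le> (\<Sum>d\<in>{d\<in>{1..P}. gcd d P = g}. h d)" if g: "g dvd P" for g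
  proof -
    let ?A = "{d\<in>{1..P}. gcd d P = g}"
    have g0: "g > 0" using g P by (auto intro: Nat.gr0I)
    have gA: "g \<in> ?A" using g g0 P by (auto simp: dvd_imp_le gcd_nat.absorb1)
    have "moebius g * moebius g = 1" using mu[OF g] by (auto simp: abs_if split: if_splits)
    then have hg: "h g = 1 / real g"
      using g g0 by (simp add: h_def gcd_nat.absorb1 power2_eq_square)
    \<comment> \<open>The other members of the class are g e with e >= 2, so together they take away
      at most 3/4 of the leading 1/g.\<close>
    have sub: "?A - {g} \<subseteq> (*) g ` {2..P}"
    proof
      fix d assume d: "d \<in> ?A - {g}"
      then have "g dvd d" by auto
      then obtain e where e: "d = g * e" by auto
      have "e \<noteq> 0" "e \<noteq> 1" using d e by auto
      moreover have "e \<le> d" using e g0 by simp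
      ultimately have "e \<in> {2..P}" using d by auto
      then show "d \<in> (*) g ` {2..P}" using e by blast
    qed
    have "\<bar>\<Sum>d\<in>?A - {g}. h d\<bar> \<le> (\<Sum>d\<in>?A - {g}. real g / (real d)\<^sup>2)"
    proof (rule order_trans[OF sum_abs], rule sum_mono)
      fix d assume "d \<in> ?A - {g}"
      then have "gcd d P = g" by simp
      moreover have "\<bar>moebius d\<bar> * \<bar>moebius g\<bar> \<le> 1 * 1"
        by (intro mult_mono abs_moebius_le_1) auto
      ultimately show "\<bar>h d\<bar> \<le> real g / (real d)\<^sup>2"
        by (simp add: h_def abs_mult mult_left_le_one_le divide_right_mono)
    qed
    also have "\<dots> \<le> (\<Sum>d\<in>(*) g ` {2..P}. real g / (real d)\<^sup>2)"
      using sub by (intro sum_mono2) auto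
    also have "\<dots> = (\<Sum>e=2..P. real g / (real (g * e))\<^sup>2)"
      using g0 by (subst sum.reindex) (auto simp: inj_on_def)
    also have "\<dots> = (\<Sum>e=2..P. 1 / real g * (1 / (real e)\<^sup>2))"
      using g0 by (intro sum.cong) (auto simp: power2_eq_square)
    also have "\<dots> \<le> 1 / real g * (3 / 4)"
      unfolding sum_distrib_left[symmetric]
      by (intro mult_left_mono sum_inverse_squares_from_2_le) auto
    finally have "\<bar>\<Sum>d\<in>?A - {g}. h d\<bar> \<le> 1 / real g * (3 / 4)" .
    moreover have "(\<Sum>d\<in>?A. h d) = h g + (\<Sum>d\<in>?A - {g}. h d)"
      using gA by (intro sum.remove) auto
    moreover have "a / 4 \<le> y" if "\<bar>x\<bar> \<le> a * (3 / 4)" "y = a + x" for a x y :: real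
      using that by linarith
    ultimately show ?thesis unfolding hg by blast
  qed
  then have "(\<Sum>g | g dvd P. 1 / real g / 4) \<le> (\<Sum>g | g dvd P. \<Sum>d\<in>{d\<in>{1..P}. gcd d P = g}. h d)"
    by (intro sum_mono) auto
  also have "\<dots> = (\<Sum>d=1..P. h d)"
    using P by (intro sum.group) auto
  finally show ?thesis by (simp add: h_def sum_divide_distrib)
qed

section \<open>Means of sawtooth sums and of E_Delta\<close>

text \<open>The step P/(b d) has lowest terms u/v, with u = P/g and v = b (d/g). For the offset
  \<beta>, v \<beta> is the odd quarter u (4 n + r)/4, so \<open>sawtooth_quarter\<close> evaluates
  the mean.\<close>

lemma sum_sawtooth_small_divisor:
  fixes P b r d n N :: nat
  assumes P: "odd P" and r: "odd r" and "b > 0" "d > 0" and cop: "coprime P b"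
  shows "\<bar>(\<Sum>k<N. sawtooth (real P * real (4 * (n + k) + r) / (4 * real b) / real d))
     + real N * chi4 r * chi4 (P div gcd d P) * real (gcd d P) / (4 * real b * real d)\<bar> \<le> real b * real d"
proof -
  define g where "g = gcd d P"
  define u where "u = P div g"
  define v where "v = b * (d div g)"
  have g: "g > 0" "g dvd d" "g dvd P" using assms by (auto simp: g_def)
  have Pu: "P = g * u" and dg: "d = g * (d div g)" using g by (auto simp: u_def)
  have dg0: "d div g > 0" using dg \<open>d > 0\<close> by (metis mult_is_0 neq0_conv)
  have "coprime u b" using cop Pu by (metis coprime_mult_left_iff)
  moreover have "coprime u (d div g)"
    using div_gcd_coprime[of d P] assms by (simp add: u_def g_def coprime_commute)
  ultimately have uv: "coprime u v" by (simp add: v_def)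
  have v0: "v > 0" using dg0 assms by (simp add: v_def)
  have rv: "real v = real b * real d / real g"
    using g by (simp add: v_def real_of_nat_div)
  have ru: "real P = real g * real u" by (subst Pu) simp
  define \<beta> where "\<beta> = real u * real (4 * n + r) / (4 * real v)"
  have arg: "real P * real (4 * (n + k) + r) / (4 * real b) / real d = real k * real u / real v + \<beta>" for k
    unfolding \<beta>_def rv ru using g assms by (simp add: field_simps)
  have "odd u" using P Pu by (metis even_mult_iff)
  then have odd: "odd (u * (4 * n + r))" using r by simp
  have "real v * \<beta> = real (u * (4 * n + r)) / 4"
    using v0 by (simp add: \<beta>_def)
  then have "sawtooth (real v * \<beta>) = - (chi4 r * chi4 u) / 4"
    using sawtooth_quarter[OF odd] by (simp only: chi4_mult chi4_add_mult_4) (simp add: mult.commute)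
  then have "real N / real v * sawtooth (real v * \<beta>) =
     - (real N * chi4 r * chi4 u * real g / (4 * real b * real d))"
    using g assms by (simp add: rv mult_ac)
  then have "\<bar>(\<Sum>k<N. sawtooth (real P * real (4 * (n + k) + r) / (4 * real b) / real d))
     + real N * chi4 r * chi4 u * real g / (4 * real b * real d)\<bar> \<le> real v"
    using sum_sawtooth_rational_step[OF uv v0, where N = N and \<beta> = \<beta>] by (simp only: arg)
  also have "real v \<le> real b * real d"
  proof -
    have "real b * real d * 1 \<le> real b * real d * real g"
      using g by (intro mult_left_mono) (auto simp: Suc_le_eq)
    then show ?thesis using g by (simp add: rv divide_le_eq)
  qed
  finally show ?thesis by (simp add: u_def g_def)
qed

text \<open>The error b d of the rational-step estimate is too big for such d, but the step P/(b d)
  is now below 1 and the comparison with an integral applies.\<close>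

lemma sum_sawtooth_large_divisor:
  fixes P b r d n N :: nat
  assumes "b > 0" "P > 0" "P < d"
  shows "\<bar>\<Sum>k<N. sawtooth (real P * real (4 * (n + k) + r) / (4 * real b) / real d)\<bar>
     \<le> 2 * real b * real d / real P + 2 * real N * real P / (real b * real d)"
proof -
  define \<theta> where "\<theta> = real P / (real b * real d)"
  have bd: "real P < real b * real d"
  proof -
    have "P < b * d" using assms by (metis le_less_trans mult_le_mono1 nat_mult_1 Suc_leI One_nat_def order_less_le_trans)
    then show ?thesis by (metis of_nat_less_iff of_nat_mult)
  qed
  have \<theta>: "0 < \<theta>" "\<theta> < 1" using assms bd by (auto simp: \<theta>_def)
  define \<beta> where "\<beta> = real P * real (4 * n + r) / (4 * real b * real d)"
  have arg: "real P * real (4 * (n + k) + r) / (4 * real b) / real d = real k * \<theta> + \<beta>" for k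
    using assms by (simp add: \<beta>_def \<theta>_def field_simps)
  show ?thesis
    using sum_sawtooth_small_step[OF \<theta>, where N = N and \<beta> = \<beta>] unfolding arg by (simp add: \<theta>_def)
qed

lemma sum_moebius_sawtooth_progression:
  fixes P b r n :: nat
  assumes P: "odd P" and r: "odd r" and b: "b > 0" and cop: "coprime P b"
  shows "\<bar>(\<Sum>k<P. \<Sum>d=1..2 * P\<^sup>2. moebius d / real d *
              sawtooth (real P * real (4 * (n + k) + r) / (4 * real b) / real d))
     + real P * chi4 r / (4 * real b) *
         (\<Sum>d=1..P. moebius d * chi4 (P div gcd d P) * real (gcd d P) / (real d)\<^sup>2)\<bar> \<le> 7 * real b * real P"
proof -
  define A where "A d = (\<Sum>k<P. sawtooth (real P * real (4 * (n + k) + r) / (4 * real b) / real d))" for d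
  define c where "c d = real P * chi4 r * chi4 (P div gcd d P) * real (gcd d P) / (4 * real b * real d)" for d
  have P0: "P > 0" using P by (auto intro: Nat.gr0I)
  then have P2: "P \<le> 2 * P\<^sup>2" by (simp add: power2_eq_square)
  have "(\<Sum>k<P. \<Sum>d=1..2 * P\<^sup>2. moebius d / real d *
              sawtooth (real P * real (4 * (n + k) + r) / (4 * real b) / real d))
     = (\<Sum>d=1..2 * P\<^sup>2. moebius d / real d * A d)"
    unfolding A_def sum_distrib_left by (rule sum.swap)
  also have "\<dots> = (\<Sum>d\<in>{1..P} \<union> {P<..2 * P\<^sup>2}. moebius d / real d * A d)"
    using P2 by (intro sum.cong) auto
  also have "\<dots> = (\<Sum>d=1..P. moebius d / real d * A d) + (\<Sum>d\<in>{P<..2 * P\<^sup>2}. moebius d / real d * A d)"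
    by (intro sum.union_disjoint) auto
  finally have split: "(\<Sum>k<P. \<Sum>d=1..2 * P\<^sup>2. moebius d / real d *
              sawtooth (real P * real (4 * (n + k) + r) / (4 * real b) / real d))
     = (\<Sum>d=1..P. moebius d / real d * A d) + (\<Sum>d\<in>{P<..2 * P\<^sup>2}. moebius d / real d * A d)" .
  have main: "real P * chi4 r / (4 * real b) *
         (\<Sum>d=1..P. moebius d * chi4 (P div gcd d P) * real (gcd d P) / (real d)\<^sup>2)
     = (\<Sum>d=1..P. moebius d / real d * c d)"
    unfolding sum_distrib_left by (intro sum.cong) (auto simp: c_def power2_eq_square mult_ac)
  \<comment> \<open>The weight 1/d reduces the error b d to b for each d, in total b P.\<close>
  have small: "\<bar>(\<Sum>d=1..P. moebius d / real d * A d) + (\<Sum>d=1..P. moebius d / real d * c d)\<bar> \<le> real b * real P"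
  proof -
    have "\<bar>\<Sum>d=1..P. moebius d / real d * (A d + c d)\<bar> \<le> (\<Sum>d=1..P. real b)"
    proof (rule order_trans[OF sum_abs], rule sum_mono)
      fix d assume d: "d \<in> {1..P}"
      have "\<bar>moebius d / real d\<bar> * \<bar>A d + c d\<bar> \<le> 1 / real d * (real b * real d)"
        using sum_sawtooth_small_divisor[OF P r b _ cop, where d = d and N = P and n = n] d abs_moebius_le_1[of d]
        unfolding A_def c_def by (intro mult_mono) (auto simp: divide_right_mono)
      then show "\<bar>moebius d / real d * (A d + c d)\<bar> \<le> real b"
        using d by (simp add: abs_mult)
    qed
    then show ?thesis by (simp add: distrib_left add_divide_distrib sum.distrib mult.commute)
  qed
  \<comment> \<open>Fewer than 2 P^2 terms 2 b/P give 4 b P, and the tail of 1/d^2 gives 2 P/b <= 2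
    b P.\<close>
  have large: "\<bar>\<Sum>d\<in>{P<..2 * P\<^sup>2}. moebius d / real d * A d\<bar> \<le> 6 * real b * real P"
  proof -
    have "\<bar>\<Sum>d\<in>{P<..2 * P\<^sup>2}. moebius d / real d * A d\<bar> \<le>
      (\<Sum>d\<in>{P<..2 * P\<^sup>2}. 2 * real b / real P + 2 * (real P)\<^sup>2 / real b * (1 / (real d)\<^sup>2))"
    proof (rule order_trans[OF sum_abs], rule sum_mono)
      fix d assume d: "d \<in> {P<..2 * P\<^sup>2}"
      have "\<bar>moebius d / real d\<bar> * \<bar>A d\<bar> \<le>
        1 / real d * (2 * real b * real d / real P + 2 * real P * real P / (real b * real d))"
        using sum_sawtooth_large_divisor[OF b P0, where d = d and N = P and n = n and r = r] d abs_moebius_le_1[of d]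
        unfolding A_def by (intro mult_mono) (auto simp: divide_right_mono)
      also have "\<dots> = 2 * real b / real P + 2 * (real P)\<^sup>2 / real b * (1 / (real d)\<^sup>2)"
        using d b P0 by (simp add: distrib_left power2_eq_square mult_ac)
      finally show "\<bar>moebius d / real d * A d\<bar> \<le> 2 * real b / real P + 2 * (real P)\<^sup>2 / real b * (1 / (real d)\<^sup>2)"
        by (simp add: abs_mult)
    qed
    also have "\<dots> = real (2 * P\<^sup>2 - P) * (2 * real b / real P) +
       2 * (real P)\<^sup>2 / real b * (\<Sum>d\<in>{P<..2 * P\<^sup>2}. 1 / (real d)\<^sup>2)"
      by (simp add: sum.distrib sum_distrib_left)
    also have "\<dots> \<le> 2 * (real P)\<^sup>2 * (2 * real b / real P) + 2 * (real P)\<^sup>2 / real b * (1 / real P)"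
    proof (intro add_mono mult_right_mono mult_left_mono sum_inverse_squares_le[OF P0])
      have "real (2 * P\<^sup>2 - P) \<le> real (2 * P\<^sup>2)" by (simp only: of_nat_le_iff diff_le_self)
      then show "real (2 * P\<^sup>2 - P) \<le> 2 * (real P)\<^sup>2" by simp
    qed auto
    also have "\<dots> = 4 * real b * real P + 2 * real P / real b"
      using P0 by (simp add: power2_eq_square)
    also have "2 * real P / real b \<le> 2 * real P * real b"
    proof -
      have "1 \<le> real b * real b" using b by (simp add: mult_ge1_I Suc_le_eq)
      then have "2 * real P * 1 \<le> 2 * real P * (real b * real b)" by (intro mult_left_mono) auto
      then show ?thesis using b by (simp add: divide_le_eq mult_ac)
    qed
    finally show ?thesis by (simp add: mult_ac)
  qed
  show ?thesis unfolding split main using small large by linarith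
qed

text \<open>The factor 16 b combines the 4 b of the sawtooth mean with the 4 of
  \<open>sum_moebius_gcd_ge\<close>. The loss 9 b is 2 b from replacing E_Delta by the sawtooth sum
  plus 7 b from evaluating that sum.\<close>

lemma E_Delta_progression_mean:
  fixes b r :: nat and S :: "nat set"
  assumes S: "finite S" "\<And>p. p \<in> S \<Longrightarrow> prime p \<and> p mod 4 = 3 \<and> \<not> p dvd b"
    and b: "b > 0" and r: "r = 1 \<or> r = 3"
  defines "P \<equiv> \<Prod>S"
  defines "t \<equiv> \<lambda>k. real P * real (4 * (P + k) + r) / (4 * real b)"
  shows "real P * ((\<Prod>p\<in>S. 1 + 1 / real p) / (16 * real b) - 9 * real b)
    \<le> chi4 r * chi4 P * (\<Sum>k<P. E_Delta (t k) / t k)"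
proof -
  have P0: "P > 0" using S by (auto simp: P_def intro!: prod_pos prime_gt_0_nat)
  have mu: "chi4 g = moebius g" "\<bar>moebius g\<bar> = 1" if "g dvd P" for g
    using chi4_eq_moebius[OF S(1), of g] S(2) that by (auto simp: P_def)
  have "chi4 P \<noteq> 0" using mu[of P] by auto
  then have P: "odd P" by (auto simp: chi4_def split: if_splits) presburger+
  have cop: "coprime P b"
    unfolding P_def using S by (intro prod_coprime_left) (auto intro: prime_imp_coprime)
  define \<sigma> where "\<sigma> = chi4 r * chi4 P"
  have \<sigma>: "\<sigma> * \<sigma> = 1" "\<bar>\<sigma>\<bar> = 1"
    using r mu[of P] by (auto simp: \<sigma>_def abs_mult abs_if split: if_splits)
  define Y where "Y = (\<Sum>d=1..P. moebius d * moebius (gcd d P) * real (gcd d P) / (real d)\<^sup>2)"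
  have "(\<Prod>p\<in>S. 1 + 1 / real p) / 4 \<le> (\<Sum>g | g dvd P. 1 / real g) / 4"
    using prod_le_sum_inverse_divisors[OF S(1)] S(2) by (simp add: P_def)
  also have "\<dots> \<le> Y"
    unfolding Y_def by (rule sum_moebius_gcd_ge[OF P0 mu(2)])
  finally have Y: "(\<Prod>p\<in>S. 1 + 1 / real p) / 4 \<le> Y" .
  \<comment> \<open>The value of \<open>chi4\<close> at the gcd is its \<open>moebius\<close> value,
    a sign, so dividing by it is multiplying by it.\<close>
  have chi_div: "chi4 (P div gcd d P) = chi4 P * moebius (gcd d P)" for d
  proof -
    let ?g = "gcd d P"
    have "P = ?g * (P div ?g)" by simp
    then have "chi4 P = moebius ?g * chi4 (P div ?g)" using mu(1)[of ?g] by (metis chi4_mult gcd_dvd2)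
    moreover have "moebius ?g * moebius ?g = 1" using mu(2)[of ?g] by (auto simp: abs_if split: if_splits)
    ultimately show ?thesis by (simp add: algebra_simps)
  qed
  have main: "real P * chi4 r / (4 * real b) *
         (\<Sum>d=1..P. moebius d * chi4 (P div gcd d P) * real (gcd d P) / (real d)\<^sup>2) = real P / (4 * real b) * \<sigma> * Y"
    unfolding chi_div Y_def \<sigma>_def sum_distrib_left by (intro sum.cong) (auto simp: mult_ac)
  \<comment> \<open>All sample points have order P^2, so the single cutoff 2 P^2 makes the error of
    \<open>E_Delta_approx\<close> proportional to t.\<close>
  have t: "real P * real P / real b \<le> t k" "0 < t k" "t k \<le> real (2 * P\<^sup>2)" if "k < P" for k
  proof -
    have "4 * real P \<le> real (4 * (P + k) + r)" by simp
    then have "real P * (4 * real P) / (4 * real b) \<le> t k"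
      unfolding t_def by (intro divide_right_mono mult_left_mono) auto
    then show le: "real P * real P / real b \<le> t k" by simp
    have "0 < real P * real P / real b" using P0 b by simp
    with le show "0 < t k" by linarith
    have "4 * (P + k) + r \<le> 8 * P" using that r by auto
    then have "real (4 * (P + k) + r) \<le> real (8 * P)" by (simp only: of_nat_le_iff)
    then have "t k \<le> real P * (8 * real P) / (4 * 1)"
      unfolding t_def using b by (intro frac_le mult_left_mono) auto
    then show "t k \<le> real (2 * P\<^sup>2)" by (simp add: power2_eq_square)
  qed
  let ?W = "\<lambda>k. \<Sum>d=1..2 * P\<^sup>2. moebius d / real d * sawtooth (t k / real d)"
  have approx: "\<bar>E_Delta (t k) / t k + ?W k\<bar> \<le> 2 * real b" if k: "k < P" for k
  proof -
    note tk = t[OF k]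
    have b1: "1 \<le> real b" using b by simp
    have Pp: "1 \<le> (real P)\<^sup>2" using P0 by (simp add: Suc_le_eq)
    have "E_Delta (t k) / t k + ?W k = (E_Delta (t k) + t k * ?W k) / t k"
      using tk by (simp add: add_divide_distrib)
    then have "\<bar>E_Delta (t k) / t k + ?W k\<bar> = \<bar>E_Delta (t k) + t k * ?W k\<bar> / t k"
      using tk by simp
    also have "\<dots> \<le> ((t k)\<^sup>2 / (2 * real (2 * P\<^sup>2)) + real (2 * P\<^sup>2) / 8 + 1) / t k"
      using tk by (intro divide_right_mono E_Delta_approx) auto
    also have "\<dots> = t k / (2 * real (2 * P\<^sup>2)) + ((real P)\<^sup>2 / 4 + 1) / t k"
      using tk by (simp add: add_divide_distrib power2_eq_square)
    also have "\<dots> \<le> 1 / 2 + (5 / 4 * (real P)\<^sup>2) / (real P * real P / real b)"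
    proof (rule add_mono)
      show "t k / (2 * real (2 * P\<^sup>2)) \<le> 1 / 2" using tk P0 by (simp add: divide_le_eq)
      show "((real P)\<^sup>2 / 4 + 1) / t k \<le> (5 / 4 * (real P)\<^sup>2) / (real P * real P / real b)"
        using tk P0 b Pp by (intro frac_le) auto
    qed
    also have "\<dots> = 1 / 2 + 5 / 4 * real b" using P0 by (simp add: power2_eq_square)
    also have "\<dots> \<le> 2 * real b" using b1 by linarith
    finally show ?thesis .
  qed
  have "\<bar>(\<Sum>k<P. E_Delta (t k) / t k) + (\<Sum>k<P. ?W k)\<bar> \<le> (\<Sum>k<P. 2 * real b)"
    unfolding sum.distrib[symmetric] by (rule order_trans[OF sum_abs], rule sum_mono) (use approx in auto)
  moreover have "\<bar>(\<Sum>k<P. ?W k) + real P / (4 * real b) * \<sigma> * Y\<bar> \<le> 7 * real b * real P"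
    using sum_moebius_sawtooth_progression[OF P _ b cop, of r P] r unfolding main t_def by auto
  moreover have "\<bar>x - z\<bar> \<le> 9 * real b * real P"
    if "\<bar>x + w\<bar> \<le> (\<Sum>k<P. 2 * real b)" "\<bar>w + z\<bar> \<le> 7 * real b * real P" for x w z :: real
    using that by (simp add: mult_ac)
  ultimately have "\<bar>(\<Sum>k<P. E_Delta (t k) / t k) - real P / (4 * real b) * \<sigma> * Y\<bar> \<le> 9 * real b * real P"
    by blast
  then have "\<bar>\<sigma>\<bar> * \<bar>(\<Sum>k<P. E_Delta (t k) / t k) - real P / (4 * real b) * \<sigma> * Y\<bar> \<le> 9 * real b * real P"
    using \<sigma> by simp
  then have "\<bar>\<sigma> * (\<Sum>k<P. E_Delta (t k) / t k) - (\<sigma> * \<sigma>) * (real P / (4 * real b) * Y)\<bar> \<le> 9 * real b * real P"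
    unfolding abs_mult[symmetric] by (simp add: algebra_simps)
  then have "real P / (4 * real b) * Y - 9 * real b * real P \<le> \<sigma> * (\<Sum>k<P. E_Delta (t k) / t k)"
    unfolding \<sigma> by linarith
  moreover have "real P / (4 * real b) * ((\<Prod>p\<in>S. 1 + 1 / real p) / 4) \<le> real P / (4 * real b) * Y"
    using Y by (intro mult_left_mono) auto
  ultimately show ?thesis
    unfolding \<sigma>_def by (simp add: right_diff_distrib mult_ac)
qed

section \<open>Oscillation\<close>

lemma positive_rational_as_nat_fraction:
  fixes x :: real
  assumes "x \<in> \<rat>" "x > 0"
  shows "\<exists>p q :: nat. p > 0 \<and> q > 0 \<and> x = real p / real q"
proof -
  obtain p q :: nat where q: "q \<noteq> 0" and "\<bar>x\<bar> = real p / real q"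
    using Rats_abs_nat_div_natE[OF assms(1)] by metis
  then have x: "x = real p / real q" using assms by simp
  then have "p \<noteq> 0" using assms by (intro notI) simp
  with q x show ?thesis by blast
qed

text \<open>For f i = p i/q i, take \<nu> as the inverse of 4 times the product of all p j; then b i
  is q i times the product of the other p j. Thus one progression of x serves all dilations at
  once.\<close>

lemma common_scale:
  fixes f :: "'a \<Rightarrow> real"
  assumes "finite I" "\<And>i. i \<in> I \<Longrightarrow> f i \<in> \<rat> \<and> f i > 0"
  shows "\<exists>\<nu>>0. \<exists>b::'a \<Rightarrow> nat. \<forall>i\<in>I. b i > 0 \<and> f i * \<nu> = 1 / (4 * real (b i))"
proof -
  have "\<forall>i\<in>I. \<exists>p q :: nat. p > 0 \<and> q > 0 \<and> f i = real p / real q"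
    using assms positive_rational_as_nat_fraction by blast
  then obtain p q :: "'a \<Rightarrow> nat" where pq: "\<And>i. i \<in> I \<Longrightarrow> p i > 0 \<and> q i > 0 \<and> f i = real (p i) / real (q i)"
    by metis
  define \<nu> where "\<nu> = 1 / (4 * real (prod p I))"
  have pos: "prod p J > 0" if "J \<subseteq> I" for J
    using that pq by (intro prod_pos) auto
  show ?thesis
  proof (intro exI[of _ \<nu>] conjI exI[of _ "\<lambda>i. q i * prod p (I - {i})"] ballI)
    show "\<nu> > 0" using pos[of I] by (simp add: \<nu>_def del: of_nat_prod)
    fix i assume i: "i \<in> I"
    then show "0 < q i * prod p (I - {i})" using pq pos[of "I - {i}"] by auto
    have "prod p I = p i * prod p (I - {i})" using assms(1) i by (rule prod.remove)
    then show "f i * \<nu> = 1 / (4 * real (q i * prod p (I - {i})))"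
      using pq[OF i] by (simp add: \<nu>_def del: of_nat_prod)
  qed
qed

lemma Omega_plus_minusI:
  fixes F g :: "real \<Rightarrow> real"
  assumes "\<And>\<sigma>. \<bar>\<sigma>\<bar> = 1 \<Longrightarrow> \<exists>\<delta>>0. \<forall>X. \<exists>x\<ge>X. \<delta> \<le> \<sigma> * F x / g x"
  shows "Omega_plus_minus F g"
proof -
  obtain \<delta> where \<delta>: "\<delta> > 0" "\<And>X. \<exists>x\<ge>X. \<delta> \<le> F x / g x"
    using assms[of 1] by auto
  have "ereal \<delta> \<le> Limsup at_top (\<lambda>x. ereal (F x / g x))"
  proof (rule ccontr)
    assume "\<not> ?thesis"
    then have "\<forall>\<^sub>F x in at_top. ereal (F x / g x) < ereal \<delta>"
      by (intro Limsup_lessD) simp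
    then obtain X where "\<And>x. x \<ge> X \<Longrightarrow> F x / g x < \<delta>"
      by (auto simp: eventually_at_top_linorder)
    then show False using \<delta>(2)[of X] by (meson not_less)
  qed
  moreover obtain \<delta>' where \<delta>': "\<delta>' > 0" "\<And>X. \<exists>x\<ge>X. \<delta>' \<le> - F x / g x"
    using assms[of "-1"] by auto
  have "Liminf at_top (\<lambda>x. ereal (F x / g x)) \<le> ereal (- \<delta>')"
  proof (rule ccontr)
    assume "\<not> ?thesis"
    then have "\<forall>\<^sub>F x in at_top. ereal (- \<delta>') < ereal (F x / g x)"
      by (intro less_LiminfD) simp
    then obtain X where "\<And>x. x \<ge> X \<Longrightarrow> - \<delta>' < F x / g x"
      by (auto simp: eventually_at_top_linorder)
    then show False using \<delta>'(2)[of X] by fastforce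
  qed
  moreover have "(0 :: ereal) < ereal \<delta>" "ereal (- \<delta>') < 0"
    using \<delta>(1) \<delta>'(1) by simp_all
  ultimately show ?thesis
    unfolding Omega_plus_minus_def by (blast intro: less_le_trans le_less_trans)
qed

text \<open>The means for the individual i are added with the positive weights c i * f i, where f i
  cancels against the denominator f i * x. All have the same sign, so some sample point reaches the
  averaged lower bound.\<close>

lemma large_value_in_progression:
  fixes c f :: "nat \<Rightarrow> real" and b :: "nat \<Rightarrow> nat" and S :: "nat set" and \<nu> \<sigma> :: real
  assumes S: "finite S" "\<And>p. p \<in> S \<Longrightarrow> prime p \<and> p mod 4 = 3 \<and> \<not> p dvd (\<Prod>i\<in>I. b i)"
    and I: "finite I" and cf: "\<And>i. i \<in> I \<Longrightarrow> c i > 0 \<and> f i > 0"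
    and b: "\<And>i. i \<in> I \<Longrightarrow> b i > 0 \<and> f i * \<nu> = 1 / (4 * real (b i))"
    and \<nu>: "\<nu> > 0" and \<sigma>: "\<bar>\<sigma>\<bar> = 1"
  defines "P \<equiv> \<Prod>S"
  shows "\<exists>x. 4 * \<nu> * (real P)\<^sup>2 \<le> x \<and> x \<le> 8 * \<nu> * (real P)\<^sup>2 \<and>
     (\<Sum>i\<in>I. c i * f i / (16 * real (b i))) * (\<Prod>p\<in>S. 1 + 1 / real p) - (\<Sum>i\<in>I. 9 * c i * f i * real (b i))
       \<le> \<sigma> * (\<Sum>i\<in>I. c i * E_Delta (f i * x)) / x"
proof -
  define Q where "Q = (\<Prod>p\<in>S. 1 + 1 / real p)"
  define R where "R = (\<Sum>i\<in>I. c i * f i / (16 * real (b i))) * Q - (\<Sum>i\<in>I. 9 * c i * f i * real (b i))"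
  have P0: "P > 0" using S by (auto simp: P_def intro!: prod_pos prime_gt_0_nat)
  have "chi4 P = moebius P \<and> \<bar>moebius P\<bar> = 1"
    using chi4_eq_moebius[OF S(1), of P] S(2) by (auto simp: P_def)
  then have "chi4 P = 1 \<or> chi4 P = -1" by (auto simp: abs_if split: if_splits)
  moreover have "\<sigma> = 1 \<or> \<sigma> = -1" using \<sigma> by (auto simp: abs_if split: if_splits)
  \<comment> \<open>Take r = 1 if \<open>chi4 P\<close> already equals \<sigma>, and r = 3
    otherwise.\<close>
  ultimately obtain r :: nat where r: "r = 1 \<or> r = 3" "chi4 r * chi4 P = \<sigma>"
    by (cases "chi4 P = \<sigma>") (force intro: that[of 1] that[of 3])+
  define x where "x k = \<nu> * real P * real (4 * (P + k) + r)" for k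
  have x0: "x k > 0" for k
    using \<nu> P0 by (simp add: x_def add_pos_nonneg)
  define h where "h k = \<sigma> * (\<Sum>i\<in>I. c i * E_Delta (f i * x k)) / x k" for k
  have "real P * R = (\<Sum>i\<in>I. c i * f i * (real P * (Q / (16 * real (b i)) - 9 * real (b i))))"
    unfolding R_def by (simp add: algebra_simps sum_subtractf sum_distrib_left sum_distrib_right)
  also have "\<dots> \<le> (\<Sum>i\<in>I. c i * f i * (\<sigma> * (\<Sum>k<P. E_Delta (f i * x k) / (f i * x k))))"
  proof (intro sum_mono mult_left_mono)
    fix i assume i: "i \<in> I"
    have "f i * x k = real P * real (4 * (P + k) + r) / (4 * real (b i))" for k
    proof -
      have "f i * x k = (f i * \<nu>) * (real P * real (4 * (P + k) + r))"
        by (simp add: x_def)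
      also have "f i * \<nu> = 1 / (4 * real (b i))" using b[OF i] by blast
      finally show ?thesis by simp
    qed
    moreover have "\<not> p dvd b i" if "p \<in> S" for p
      using S(2)[OF that] I i by (meson dvd_prodI dvd_trans)
    ultimately show "real P * (Q / (16 * real (b i)) - 9 * real (b i))
       \<le> \<sigma> * (\<Sum>k<P. E_Delta (f i * x k) / (f i * x k))"
      using E_Delta_progression_mean[OF S(1), of "b i" r] S(2) b[OF i] r
      by (simp add: P_def Q_def)
    show "0 \<le> c i * f i" using cf[OF i] by simp
  qed
  also have "\<dots> = (\<Sum>i\<in>I. \<Sum>k<P. \<sigma> * (c i * E_Delta (f i * x k)) / x k)"
    unfolding sum_distrib_left
  proof (intro sum.cong refl)
    fix i k assume i: "i \<in> I"
    have "f i \<noteq> 0" "x k \<noteq> 0" using cf[OF i] x0[of k] by auto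
    then show "c i * f i * (\<sigma> * (E_Delta (f i * x k) / (f i * x k))) = \<sigma> * (c i * E_Delta (f i * x k)) / x k"
      by simp
  qed
  also have "\<dots> = (\<Sum>k<P. \<Sum>i\<in>I. \<sigma> * (c i * E_Delta (f i * x k)) / x k)"
    by (rule sum.swap)
  also have "\<dots> = (\<Sum>k<P. h k)"
    by (simp add: h_def sum_distrib_left sum_divide_distrib)
  finally have "real P * R \<le> (\<Sum>k<P. h k)" .
  moreover have "(\<Sum>k<P. h k) < (\<Sum>k<P. R)" if "\<And>k. k < P \<Longrightarrow> h k < R"
    using that P0 by (intro sum_strict_mono) auto
  ultimately obtain k where k: "k < P" "R \<le> h k"
    by (force simp: not_less)
  have "4 * real P \<le> real (4 * (P + k) + r)" by simp
  moreover have "real (4 * (P + k) + r) \<le> 8 * real P"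
  proof -
    have "4 * (P + k) + r \<le> 8 * P" using k r by auto
    then have "real (4 * (P + k) + r) \<le> real (8 * P)" by (simp only: of_nat_le_iff)
    then show ?thesis by simp
  qed
  ultimately have "\<nu> * real P * (4 * real P) \<le> x k" "x k \<le> \<nu> * real P * (8 * real P)"
    unfolding x_def using \<nu> by (intro mult_left_mono; simp)+
  then have "4 * \<nu> * (real P)\<^sup>2 \<le> x k" "x k \<le> 8 * \<nu> * (real P)\<^sup>2"
    by (simp_all add: power2_eq_square mult_ac)
  then show ?thesis
    using k unfolding R_def Q_def h_def by blast
qed

theorem theorem1p5:
  fixes k :: nat and c f :: "nat \<Rightarrow> real"
  assumes "k \<ge> 1"
    and "\<And>i. i \<in> {1..k} \<Longrightarrow> c i \<in> \<rat> \<and> c i > 0"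
    and "\<And>i. i \<in> {1..k} \<Longrightarrow> f i \<in> \<rat> \<and> f i > 0"
  shows "Omega_plus_minus (\<lambda>x. \<Sum>i=1..k. c i * E_Delta (f i * x))
                          (\<lambda>x. x * sqrt (ln (ln x)))"
proof (rule Omega_plus_minusI)
  fix \<sigma> :: real assume \<sigma>: "\<bar>\<sigma>\<bar> = 1"
  have "finite {1..k}" by simp
  then obtain \<nu> b where \<nu>: "\<nu> > 0" and b: "\<And>i. i \<in> {1..k} \<Longrightarrow> b i > 0 \<and> f i * \<nu> = 1 / (4 * real (b i :: nat))"
    using common_scale[of "{1..k}" f] assms(3) by blast
  define B where "B = (\<Prod>i=1..k. b i)"
  have "B > 0" unfolding B_def using b by (intro prod_pos) auto
  define S where "S m = {p. prime p \<and> p \<le> 2 * m \<and> p mod 4 = 3 \<and> \<not> p dvd B}" for m :: nat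
  define Q where "Q m = (\<Prod>p\<in>S m. 1 + 1 / real p)" for m
  define P where "P m = \<Prod>(S m)" for m
  define s where "s m = sqrt (ln (real m + 1))" for m :: nat
  obtain \<kappa> where \<kappa>: "\<kappa> > 0" "\<And>m. \<kappa> * s m \<le> Q m"
    using prod_primes_3_mod_4_ge[OF \<open>B > 0\<close>] unfolding S_def Q_def s_def by blast
  define c1 where "c1 = (\<Sum>i=1..k. c i * f i / (16 * real (b i)))"
  define c0 where "c0 = (\<Sum>i=1..k. 9 * c i * f i * real (b i))"
  have c1: "c1 > 0"
    unfolding c1_def using assms b by (intro sum_pos) auto
  have fin: "finite (S m)" for m
    unfolding S_def by (rule finite_subset[of _ "{..2 * m}"]) auto
  have Sp: "prime p \<and> p \<le> 2 * m \<and> p mod 4 = 3 \<and> \<not> p dvd (\<Prod>i=1..k. b i)" if "p \<in> S m" for p m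
    using that by (auto simp: S_def B_def)
  have P0: "P m > 0" for m
    using Sp unfolding P_def by (intro prod_pos) (auto intro: prime_gt_0_nat)
  \<comment> \<open>Through this bound P m inherits the growth of s m, which pushes x beyond any
    given X.\<close>
  have QP: "Q m \<le> real (P m)" for m
    unfolding Q_def P_def of_nat_prod
  proof (intro prod_mono conjI)
    fix p assume "p \<in> S m"
    then have "2 \<le> real p" using Sp prime_ge_2_nat by (metis numeral_le_iff of_nat_le_iff of_nat_numeral)
    moreover from this have "1 / real p \<le> 1" by simp
    ultimately show "1 + 1 / real p \<le> real p" by linarith
  qed simp
  \<comment> \<open>At most 2 m primes, each at most 2 m: crude, but only the logarithm of this
    bound enters ln (ln x).\<close>
  have lnP: "ln (real (P m)) \<le> 4 * (real m)\<^sup>2" if "m > 0" for m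
  proof -
    have "card (S m) \<le> card {1..2 * m}"
      by (intro card_mono) (auto simp: S_def prime_gt_0_nat Suc_le_eq)
    then have card: "real (card (S m)) \<le> 2 * real m" by simp
    have "ln (real (P m)) = (\<Sum>p\<in>S m. ln (real p))"
      unfolding P_def of_nat_prod using Sp fin by (intro ln_prod) (auto simp: prime_gt_0_nat)
    also have "\<dots> \<le> (\<Sum>p\<in>S m. 2 * real m)"
    proof (rule sum_mono)
      fix p assume p: "p \<in> S m"
      then have "real p > 0" using Sp prime_gt_0_nat by simp
      then have "ln (real p) \<le> real p" using ln_le_minus_one[of "real p"] by linarith
      also have "real p \<le> real (2 * m)" using Sp[OF p] by (simp only: of_nat_le_iff)
      finally show "ln (real p) \<le> 2 * real m" by simp
    qed
    also have "\<dots> \<le> 2 * real m * (2 * real m)"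
      using mult_right_mono[OF card, of "2 * real m"] by simp
    finally show ?thesis by (simp add: power2_eq_square)
  qed
  \<comment> \<open>One factor 2 absorbs c0, the other covers sqrt (ln (ln x)) <= 2 s m.\<close>
  define \<delta> where "\<delta> = c1 * \<kappa> / 4"
  have "\<delta> > 0" using c1 \<kappa> by (simp add: \<delta>_def)
  moreover have "\<exists>x\<ge>X. \<delta> \<le> \<sigma> * (\<Sum>i=1..k. c i * E_Delta (f i * x)) / (x * sqrt (ln (ln x)))" for X
  proof -
    have s_lim: "filterlim s at_top at_top" unfolding s_def by real_asymp
    \<comment> \<open>The double exponential ensures ln (ln x) >= 1, so the final division is by a
      positive number.\<close>
    define Y where "Y = max X (exp (exp 1))"
    have "\<forall>\<^sub>F m in at_top. c0 / (c1 * \<kappa> / 2) \<le> s m"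
      using s_lim by (auto simp: filterlim_at_top)
    moreover have "\<forall>\<^sub>F m in at_top. Y / (4 * \<nu> * \<kappa>) \<le> s m"
      using s_lim by (auto simp: filterlim_at_top)
    \<comment> \<open>The left side bounds ln x, by x <= 8 \<nu> P^2 and \<open>lnP\<close>; hence
      ln (ln x) <= 3 ln (m+1).\<close>
    moreover have "\<forall>\<^sub>F m in at_top. ln (8 * \<nu>) + 8 * (real m)\<^sup>2 \<le> (real m + 1) ^ 3"
      by real_asymp
    moreover have "\<forall>\<^sub>F m :: nat in at_top. m > 0"
      by (rule eventually_gt_at_top)
    ultimately have "\<forall>\<^sub>F m in at_top. c0 / (c1 * \<kappa> / 2) \<le> s m \<and> Y / (4 * \<nu> * \<kappa>) \<le> s m \<and>
        ln (8 * \<nu>) + 8 * (real m)\<^sup>2 \<le> (real m + 1) ^ 3 \<and> m > 0"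
      by eventually_elim blast
    then obtain m where m: "c0 / (c1 * \<kappa> / 2) \<le> s m" "Y / (4 * \<nu> * \<kappa>) \<le> s m"
        "ln (8 * \<nu>) + 8 * (real m)\<^sup>2 \<le> (real m + 1) ^ 3" "m > 0"
      using eventually_happens'[OF sequentially_bot] by blast
    obtain x where x: "4 * \<nu> * (real (P m))\<^sup>2 \<le> x" "x \<le> 8 * \<nu> * (real (P m))\<^sup>2"
      and large: "c1 * Q m - c0 \<le> \<sigma> * (\<Sum>i=1..k. c i * E_Delta (f i * x)) / x"
      using large_value_in_progression[where S = "S m" and I = "{1..k}" and b = b and c = c and f = f and \<nu> = \<nu> and \<sigma> = \<sigma>] fin Sp assms b \<nu> \<sigma>
      unfolding c1_def c0_def Q_def P_def by auto
    have "Y \<le> 4 * \<nu> * (\<kappa> * s m)"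
      using m(2) \<nu> \<kappa> by (simp add: divide_le_eq mult_ac)
    also have "\<dots> \<le> 4 * \<nu> * real (P m)"
      using \<nu> \<kappa>(2)[of m] QP[of m] by (intro mult_left_mono) auto
    also have "\<dots> \<le> 4 * \<nu> * (real (P m))\<^sup>2"
      using \<nu> P0[of m] by (intro mult_left_mono) (auto simp: power2_eq_square)
    finally have Yx: "Y \<le> x" using x by linarith
    then have x_ge: "exp (exp 1) \<le> x" "X \<le> x" by (auto simp: Y_def)
    have x0: "x > 0" using x_ge(1) by (rule less_le_trans[rotated]) simp
    have lnx: "exp 1 \<le> ln x" using x_ge x0 by (simp add: ln_ge_iff)
    then have lnx0: "ln x > 0" by (rule less_le_trans[rotated]) simp
    have lnlnx: "1 \<le> ln (ln x)" using lnx lnx0 by (simp add: ln_ge_iff)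
    have "ln x \<le> ln (8 * \<nu> * (real (P m))\<^sup>2)" using x x0 by simp
    also have "\<dots> = ln (8 * \<nu>) + 2 * ln (real (P m))"
      using \<nu> P0[of m] by (simp add: ln_mult ln_realpow)
    also have "\<dots> \<le> (real m + 1) ^ 3" using lnP[OF m(4)] m(3) by linarith
    finally have "ln (ln x) \<le> ln ((real m + 1) ^ 3)" using lnx0 by simp
    also have "\<dots> = 3 * ln (real m + 1)" by (simp add: ln_realpow)
    \<comment> \<open>Rounding 3 up to 4 makes the square root equal to 2 s m.\<close>
    also have "\<dots> \<le> 4 * ln (real m + 1)" by simp
    finally have "sqrt (ln (ln x)) \<le> sqrt (4 * ln (real m + 1))" by (rule real_sqrt_le_mono)
    then have sq: "sqrt (ln (ln x)) \<le> 2 * s m" by (simp add: s_def real_sqrt_mult)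
    have "\<delta> * sqrt (ln (ln x)) \<le> \<delta> * (2 * s m)"
      using sq \<open>\<delta> > 0\<close> by (intro mult_left_mono) auto
    also have "\<dots> \<le> c1 * (\<kappa> * s m) - c0"
      using m(1) c1 \<kappa>(1) by (simp add: \<delta>_def divide_le_eq mult_ac)
    also have "\<dots> \<le> c1 * Q m - c0" using c1 \<kappa>(2)[of m] by simp
    finally have "\<delta> * sqrt (ln (ln x)) \<le> \<sigma> * (\<Sum>i=1..k. c i * E_Delta (f i * x)) / x"
      using large by linarith
    then have "\<delta> \<le> \<sigma> * (\<Sum>i=1..k. c i * E_Delta (f i * x)) / x / sqrt (ln (ln x))"
      using lnlnx by (subst pos_le_divide_eq) auto
    then show ?thesis using x_ge(2) by (auto simp: divide_divide_eq_left)
  qed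
  ultimately show "\<exists>\<delta>>0. \<forall>X. \<exists>x\<ge>X. \<delta> \<le> \<sigma> * (\<Sum>i=1..k. c i * E_Delta (f i * x)) / (x * sqrt (ln (ln x)))"
    by blast
qed

end
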